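(* Let $\beta>0$. For $n\ge2$ and $1\le i\le n$ let $p_{n,i}>0$ and let $(\mathcal{X}_{n,i},K_{n,i},\pi_{n,i})$ be the irreducible Markov chain on $\mathcal{X}_{n,i}=\{0,1,\dots,2n\}$ whose transition matrix has the following nonzero entries: $$K_{n,i}(j,j+1)=1-a_{n,i}\ (j\notin\{n,2n\}),\qquad K_{n,i}(0,0)=a_{n,i},\qquad K_{n,i}(j,j-1)=a_{n,i}\ (j\neq 0),$$ $$K_{n,i}(n,n+1)=b_{n,i}n^{-\beta},\qquad K_{n,i}(n,2n)=1-a_{n,i}-b_{n,i}n^{-\beta},$$ $$K_{n,i}(2n,n)=c_{n,i},\qquad K_{n,i}(2n,2n)=1-a_{n,i}-c_{n,i},$$ and assume reversibility, i.e. $$b_{n,i}c_{n,i}(1-a_{n,i})^{n-1}n^{-\beta}=(1-a_{n,i}-b_{n,i}n^{-\beta})a_{n,i}^n .$$ Let $q_n=p_{n,1}+\cdots+p_{n,n}$ and let $\mathcal{G}=(\mathcal{X}_n,K_n,\pi_n)_{n}$, where $(\mathcal{X}_n,K_n,\pi_n)$ is the product chain of $(\mathcal{X}_{n,i},K_{n,i},\pi_{n,i})_{i=1}^n$ according to the probability vector $(p_{n,1}/q_n,\dots,p_{n,n}/q_n)$. Suppose there is $C>1$ such that $$\sum_{i=1}^na_{n,i}\le Cn^{-\beta-1},\qquad C^{-1}\le b_{n,i}\le C,\qquad\forall\,1\le i\le n,\ n\ge 2.$$ (1) For $p_{n,i}=1+2^{i-n}$, $\mathcal{G}_c$ has a total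 variation cutoff if and only if $\beta\ne1$. Further, if $\beta\in(0,1)$, then the cutoff time is $2n^2$; if $\beta\in(1,\infty)$, then the cutoff time is $n^2$. (2) For $p_{n,i}=1+(i/n)^\alpha$ with $\alpha>0$, $\mathcal{G}_c$ has a total variation cutoff if and only if $\beta\neq1$. Further, if $\beta\in(0,1)$, then the cutoff time is $2\frac{\alpha+2}{\alpha+1}n^2$; if $\beta\in(1,\infty)$, then the cutoff time is $\frac{\alpha+2}{\alpha+1}n^2$. (3) For $p_{n,i}=1+\log i/\log n$, $\mathcal{G}_c$ has a total variation cutoff with cutoff time $4n^2/(1+\min\{\beta,1\})$ for all $\beta>0$.
   Context: Product chain: given irreducible Markov chains $(\mathcal{X}_i,K_i,\pi_i)_{i=1}^n$ ($K_i$ stochastic matrix, $\pi_i$ stationary distribution) and positive $w_1,\dots,w_n$ with $\sum w_i=1$, the product chain according to $(w_1,\dots,w_n)$ is $(\mathcal{X},K,\pi)$ with $\mathcal{X}=\prod_i\mathcal{X}_i$, $\pi=\pi_1\times\cdots\times\pi_n$ and $K=\sum_{i=1}^nw_i\,I_1\otimes\cdots\otimes I_{i-1}\otimes K_i\otimes I_{i+1}\otimes\cdots\otimes I_n$, where $I_j$ is the identity matrix indexed by $\mathcal{X}_j$. $\mathcal{G}_c$ is the family of continuous time chains $(\mathcal{X}_n,H_{n,t},\pi_n)$, $H_{n,t}=e^{-t(I-K_n)}$. Put $d^{(c)}_{n,\mathrm{TV}}(t)=\sup_{x\in\mathcal{X}_n,A\subset\mathcal{X}_n}\{H_{n,t}(x,A)-\pi_n(A)\}$.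 $\mathcal{G}_c$ has a total variation cutoff with cutoff time $t_n>0$ if, as $n\to\infty$, $d^{(c)}_{n,\mathrm{TV}}(at_n)\to0$ for all $a>1$ and $d^{(c)}_{n,\mathrm{TV}}(at_n)\to1$ for all $a\in(0,1)$; it has a total variation cutoff if such $t_n$ exists. *)

theory Defs
  imports Complex_Main "HOL-Library.FuncSet"
begin

text \<open>A matrix indexed by a finite set \<open>S\<close> is a function of two arguments, of which only the
  values on \<open>S \<times> S\<close> matter.\<close>

type_synonym 'a kernel = "'a \<Rightarrow> 'a \<Rightarrow> real"

definition id_mat :: "'a kernel" where
  "id_mat x y = (if x = y then 1 else 0)"

primrec mat_pow :: "'a set \<Rightarrow> 'a kernel \<Rightarrow> nat \<Rightarrow> 'a kernel" where
  "mat_pow S M 0 = id_mat"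
| "mat_pow S M (Suc k) = (\<lambda>x y. \<Sum>z\<in>S. M x z * mat_pow S M k z y)"

definition mat_exp :: "'a set \<Rightarrow> 'a kernel \<Rightarrow> 'a kernel" where
  "mat_exp S M x y = (\<Sum>k. mat_pow S M k x y / fact k)"

definition tensor :: "'i set \<Rightarrow> ('i \<Rightarrow> 'a kernel) \<Rightarrow> ('i \<Rightarrow> 'a) kernel" where
  "tensor I M x y = (\<Prod>j\<in>I. M j (x j) (y j))"

definition stochastic :: "'a set \<Rightarrow> 'a kernel \<Rightarrow> bool" where
  "stochastic S K \<longleftrightarrow>
     (\<forall>x\<in>S. \<forall>y\<in>S. 0 \<le> K x y) \<and> (\<forall>x\<in>S. (\<Sum>y\<in>S. K x y) = 1)"

definition irreducible_kernel :: "'a set \<Rightarrow> 'a kernel \<Rightarrow> bool" where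
  "irreducible_kernel S K \<longleftrightarrow> (\<forall>x\<in>S. \<forall>y\<in>S. \<exists>k. 0 < mat_pow S K k x y)"

definition stationary_distribution :: "'a set \<Rightarrow> 'a kernel \<Rightarrow> ('a \<Rightarrow> real) \<Rightarrow> bool" where
  "stationary_distribution S K \<pi> \<longleftrightarrow>
     (\<forall>x\<in>S. 0 \<le> \<pi> x) \<and> (\<Sum>x\<in>S. \<pi> x) = 1 \<and> (\<forall>y\<in>S. (\<Sum>x\<in>S. \<pi> x * K x y) = \<pi> y)"

definition irreducible_markov_chain :: "'a set \<Rightarrow> 'a kernel \<Rightarrow> ('a \<Rightarrow> real) \<Rightarrow> bool" where
  "irreducible_markov_chain S K \<pi> \<longleftrightarrow>
     finite S \<and> S \<noteq> {} \<and> stochastic S K \<and> irreducible_kernel S K \<and> stationary_distribution S K \<pi>"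

definition product_space :: "'i set \<Rightarrow> ('i \<Rightarrow> 'a set) \<Rightarrow> ('i \<Rightarrow> 'a) set" where
  "product_space I X = (\<Pi>\<^sub>E i\<in>I. X i)"

text \<open>The \<open>i\<close>-th summand is the tensor product of identity matrices with \<open>K i\<close> in position \<open>i\<close>.\<close>

definition product_kernel ::
    "'i set \<Rightarrow> ('i \<Rightarrow> real) \<Rightarrow> ('i \<Rightarrow> 'a kernel) \<Rightarrow> ('i \<Rightarrow> 'a) kernel" where
  "product_kernel I w K x y = (\<Sum>i\<in>I. w i * tensor I ((\<lambda>j. id_mat)(i := K i)) x y)"

definition product_distribution :: "'i set \<Rightarrow> ('i \<Rightarrow> 'a \<Rightarrow> real) \<Rightarrow> ('i \<Rightarrow> 'a) \<Rightarrow> real" where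
  "product_distribution I \<pi> x = (\<Prod>i\<in>I. \<pi> i (x i))"

definition heat_kernel :: "'a set \<Rightarrow> 'a kernel \<Rightarrow> real \<Rightarrow> 'a kernel" where
  "heat_kernel S K t = mat_exp S (\<lambda>x y. - t * (id_mat x y - K x y))"

definition tv_distance_c :: "'a set \<Rightarrow> 'a kernel \<Rightarrow> ('a \<Rightarrow> real) \<Rightarrow> real \<Rightarrow> real" where
  "tv_distance_c S K \<pi> t =
     Sup {(\<Sum>y\<in>A. heat_kernel S K t x y) - (\<Sum>y\<in>A. \<pi> y) | x A. x \<in> S \<and> A \<subseteq> S}"

text \<open>In the following two definitions the family of chains is indexed by \<open>n \<ge> n0\<close>;
  what the arguments are for smaller \<open>n\<close> is irrelevant.\<close>

definition tv_cutoff_c_at ::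
    "nat \<Rightarrow> (nat \<Rightarrow> 'a set) \<Rightarrow> (nat \<Rightarrow> 'a kernel) \<Rightarrow> (nat \<Rightarrow> 'a \<Rightarrow> real) \<Rightarrow> (nat \<Rightarrow> real) \<Rightarrow> bool"
  where
  "tv_cutoff_c_at n0 X K \<pi> t \<longleftrightarrow>
     (\<forall>n\<ge>n0. 0 < t n) \<and>
     (\<forall>a>1. (\<lambda>n. tv_distance_c (X n) (K n) (\<pi> n) (a * t n)) \<longlonglongrightarrow> 0) \<and>
     (\<forall>a. 0 < a \<and> a < 1 \<longrightarrow>
        (\<lambda>n. tv_distance_c (X n) (K n) (\<pi> n) (a * t n)) \<longlonglongrightarrow> 1)"

definition tv_cutoff_c ::
    "nat \<Rightarrow> (nat \<Rightarrow> 'a set) \<Rightarrow> (nat \<Rightarrow> 'a kernel) \<Rightarrow> (nat \<Rightarrow> 'a \<Rightarrow> real) \<Rightarrow> bool"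
  where
  "tv_cutoff_c n0 X K \<pi> \<longleftrightarrow> (\<exists>t. tv_cutoff_c_at n0 X K \<pi> t)"

text \<open>Rows and columns range over \<open>{0..2n}\<close>; for \<open>n \<ge> 2\<close> the listed positions are pairwise
  distinct, so the order of the cases is immaterial.\<close>

definition shortcut_kernel :: "real \<Rightarrow> nat \<Rightarrow> real \<Rightarrow> real \<Rightarrow> real \<Rightarrow> nat kernel" where
  "shortcut_kernel \<beta> n a b c j k =
     (if j \<notin> {n, 2 * n} \<and> k = j + 1 then 1 - a
      else if j = 0 \<and> k = 0 then a
      else if j \<noteq> 0 \<and> k = j - 1 then a
      else if j = n \<and> k = n + 1 then b * real n powr (- \<beta>)
      else if j = n \<and> k = 2 * n then 1 - a - b * real n powr (- \<beta>)
      else if j = 2 * n \<and> k = n then c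
      else if j = 2 * n \<and> k = 2 * n then 1 - a - c
      else 0)"

end

theory Submission
  imports Defs "HOL-Analysis.FPS_Convergence" "HOL-Analysis.Infinite_Products"
    "HOL-Real_Asymp.Real_Asymp"
begin

text \<open>
In continuous time the coordinates of a product chain move independently: coordinate \<open>i\<close> runs its
own chain with the clock sped up by its weight, so the heat kernel of the product is the product of
the heat kernels of the coordinates (\<open>heat_kernel_product\<close>).  The probabilities \<open>a + c\<close> of a step
that is not forward add up to \<open>O(n powr (- \<beta> - 1))\<close> over the coordinates, so that with high
probability none is made while each coordinate makes \<open>O(n)\<close> steps.  Apart from them, a coordinate
started at \<open>0\<close> walks deterministically to \<open>n\<close>; there it takes the shortcut to \<open>2 n\<close>, except
with probability \<open>\<eta> = b * n powr - \<beta>\<close>, when it needs \<open>n\<close> further steps.  Once at \<open>2 n\<close> it stays there,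
and the stationary distribution of the product is almost a point mass at the state with all
coordinates equal to \<open>2 n\<close>.  Therefore the total variation distance is, up to \<open>o(1)\<close>, the largest
probability over the starting states that some coordinate has not reached \<open>2 n\<close> yet.

The number of steps made by time \<open>t\<close> is Poisson distributed with mean \<open>t * p i / q\<close>, with
exponentially small deviations (\<open>poisson_below_upper\<close>, \<open>poisson_below_lower\<close>).  So coordinate \<open>i\<close>
arrives after time \<open>n * q / p i\<close> if it uses the shortcut and after twice that time if it does not,
and the question is which coordinates miss the shortcut.  Among \<open>m\<close> coordinates the expected number
of those that do is of the order \<open>m * n powr - \<beta>\<close>; \<open>d_upper\<close>, \<open>d_lower_fast\<close> and \<open>d_lower_slow\<close> state the
resulting bounds on the distance, uniformly in time.

If \<open>q\<close> is asymptotic to \<open>\<kappa> * n\<close> and a positive proportion of the rates is close to the minimal rate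
\<open>1\<close>, the two candidate times are \<open>\<kappa> * n\<^sup>2\<close> and \<open>2 * \<kappa> * n\<^sup>2\<close>.  The number of
coordinates that miss the shortcut is of the order \<open>n powr (1 - \<beta>)\<close>: with high probability it is large
if \<open>\<beta> < 1\<close> and zero if \<open>\<beta> > 1\<close>, while for \<open>\<beta> = 1\<close> neither has probability close to \<open>1\<close> and the distance
stays away from \<open>0\<close> and \<open>1\<close> strictly between the two times (\<open>cutoff_regular_rates\<close>).  For the rates
\<open>1 + ln i / ln n\<close>, the coordinates up to \<open>n powr \<sigma>\<close> have rate at most \<open>1 + \<sigma>\<close>, and one of them misses
the shortcut as soon as \<open>\<sigma> > \<beta>\<close>.  Hence the last arrival is that of a coordinate of rate \<open>1 + \<beta>\<close> on
the long route, at time \<open>4 * n\<^sup>2 / (1 + \<beta>)\<close>, unless \<open>\<beta> \<ge> 1\<close>, when it comes at \<open>2 * n\<^sup>2\<close>, the time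
at which coordinate \<open>1\<close>, of rate \<open>1\<close>, arrives through the shortcut (\<open>cutoff_logarithmic_rates\<close>).
\<close>

section \<open>Matrix exponentials as formal power series\<close>

text \<open>The power series in \<open>t\<close> of an entry of \<open>exp (t M)\<close>.  A linear differential equation then becomes a
recurrence for coefficients, so that uniqueness of its solution is a plain induction.\<close>

definition exp_fps :: "'a set \<Rightarrow> 'a kernel \<Rightarrow> 'a \<Rightarrow> 'a \<Rightarrow> real fps" where
  "exp_fps S M x y = Abs_fps (\<lambda>k. mat_pow S M k x y / fact k)"

lemma exp_fps_nth_0: "fps_nth (exp_fps S M x y) 0 = id_mat x y"
  by (simp add: exp_fps_def)

lemma fps_deriv_exp_fps:
  "fps_deriv (exp_fps S M x y) = (\<Sum>z\<in>S. fps_const (M x z) * exp_fps S M z y)"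
proof (rule fps_ext)
  fix k
  have "fps_nth (fps_deriv (exp_fps S M x y)) k
      = real (Suc k) * (mat_pow S M (Suc k) x y / (real (Suc k) * fact k))"
    by (simp add: exp_fps_def)
  also have "\<dots> = mat_pow S M (Suc k) x y / fact k"
    by (simp del: mat_pow.simps)
  also have "\<dots> = fps_nth (\<Sum>z\<in>S. fps_const (M x z) * exp_fps S M z y) k"
    by (simp add: exp_fps_def fps_sum_nth sum_divide_distrib)
  finally show "fps_nth (fps_deriv (exp_fps S M x y)) k = \<dots>" .
qed

text \<open>Comparing coefficients in \<open>P' = M P\<close> determines coefficient \<open>k + 1\<close> from coefficient \<open>k\<close>.  This is
how matrix exponentials are identified below: exhibit a solution of the differential equation.\<close>

lemma exp_fps_unique:
  assumes init: "\<And>x. x \<in> S \<Longrightarrow> fps_nth (P x) 0 = id_mat x y"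
    and deriv: "\<And>x. x \<in> S \<Longrightarrow> fps_deriv (P x) = (\<Sum>z\<in>S. fps_const (M x z) * P z)"
    and x: "x \<in> S"
  shows "P x = exp_fps S M x y"
proof -
  have "\<forall>x\<in>S. fps_nth (P x) k = fps_nth (exp_fps S M x y) k" for k
  proof (induction k)
    case 0
    show ?case by (simp add: init exp_fps_nth_0)
  next
    case (Suc k)
    have "fps_nth (fps_deriv (P x)) k = fps_nth (fps_deriv (exp_fps S M x y)) k" if "x \<in> S" for x
      using Suc that by (simp add: deriv fps_deriv_exp_fps fps_sum_nth del: fps_deriv_nth)
    then show ?case by simp
  qed
  then show ?thesis using x by (intro fps_ext) blast
qed

lemma abs_mat_pow_le:
  assumes "\<And>x. x \<in> S \<Longrightarrow> (\<Sum>z\<in>S. \<bar>M x z\<bar>) \<le> B" "0 \<le> B" "x \<in> S"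
  shows "\<bar>mat_pow S M k x y\<bar> \<le> B ^ k"
  using assms(3)
proof (induction k arbitrary: x)
  case 0
  show ?case by (simp add: id_mat_def)
next
  case (Suc k)
  have "\<bar>mat_pow S M (Suc k) x y\<bar> \<le> (\<Sum>z\<in>S. \<bar>M x z\<bar> * B ^ k)"
    using Suc.IH by (auto simp: abs_mult intro!: order.trans[OF sum_abs] sum_mono mult_left_mono)
  also have "\<dots> = (\<Sum>z\<in>S. \<bar>M x z\<bar>) * B ^ k" by (simp add: sum_distrib_right)
  also have "\<dots> \<le> B * B ^ k" using assms Suc.prems by (intro mult_right_mono) auto
  finally show ?case by simp
qed

lemma exp_fps_conv_radius:
  assumes "finite S" "x \<in> S"
  shows "fps_conv_radius (exp_fps S M x y) = \<infinity>"
  unfolding fps_conv_radius_def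
proof (rule conv_radius_inftyI'')
  fix t :: real
  define B where "B = (\<Sum>x\<in>S. \<Sum>z\<in>S. \<bar>M x z\<bar>)"
  have B: "(\<Sum>z\<in>S. \<bar>M x z\<bar>) \<le> B" if "x \<in> S" for x
    unfolding B_def using that assms
    by (intro member_le_sum[of x S "\<lambda>x. \<Sum>z\<in>S. \<bar>M x z\<bar>"]) (auto intro: sum_nonneg)
  have "0 \<le> B" by (auto simp: B_def intro!: sum_nonneg)
  then have bound: "\<bar>mat_pow S M k x y\<bar> \<le> B ^ k" for k
    using abs_mat_pow_le[of S M B] B assms by blast
  show "summable (\<lambda>k. fps_nth (exp_fps S M x y) k * t ^ k)"
  proof (rule summable_comparison_test')
    show "summable (\<lambda>k. inverse (fact k) * (B * \<bar>t\<bar>) ^ k)" by (rule summable_exp)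
    show "norm (fps_nth (exp_fps S M x y) k * t ^ k) \<le> inverse (fact k) * (B * \<bar>t\<bar>) ^ k"
      if "0 \<le> k" for k
      using mult_right_mono[OF bound, of "inverse (fact k) * \<bar>t\<bar> ^ k" k]
      by (simp add: exp_fps_def abs_mult power_abs power_mult_distrib field_simps)
  qed
qed

lemma mat_pow_scale: "mat_pow S (\<lambda>x y. t * M x y) k x y = t ^ k * mat_pow S M k x y"
  by (induction k arbitrary: x) (auto simp: sum_distrib_left mult_ac)

lemma mat_exp_scale_eq_eval_fps:
  "mat_exp S (\<lambda>x y. t * M x y) x y = eval_fps (exp_fps S M x y) t"
  by (simp add: mat_exp_def eval_fps_def exp_fps_def mat_pow_scale mult_ac)

lemma heat_kernel_eq_eval_fps:
  "heat_kernel S K t x y = eval_fps (exp_fps S (\<lambda>x y. K x y - id_mat x y) x y) t"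
proof -
  have "(\<lambda>x y. - t * (id_mat x y - K x y)) = (\<lambda>x y. t * (K x y - id_mat x y))"
    by (auto simp: algebra_simps)
  then show ?thesis unfolding heat_kernel_def by (simp only: mat_exp_scale_eq_eval_fps)
qed

lemma sum_id_mat_mult:
  fixes f :: "'a \<Rightarrow> 'b :: comm_ring_1"
  assumes "finite S" "x \<in> S"
  shows "(\<Sum>z\<in>S. (if x = z then 1 else 0) * f z) = f x"
proof -
  have "(\<Sum>z\<in>S. (if x = z then 1 else 0) * f z) = (\<Sum>z\<in>S. if x = z then f z else 0)"
    by (intro sum.cong) auto
  then show ?thesis using assms by simp
qed

text \<open>As \<open>K\<close> commutes with the identity, \<open>exp (t (K - 1)) = exp (- t) exp (t K)\<close>.\<close>

lemma exp_fps_diff_id: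
  assumes "finite S" "x \<in> S"
  shows "exp_fps S (\<lambda>x y. K x y - id_mat x y) x y = fps_exp (- 1) * exp_fps S K x y"
proof (rule exp_fps_unique[of S "\<lambda>x. fps_exp (- 1) * exp_fps S K x y", symmetric])
  fix x assume x: "x \<in> S"
  let ?e = "fps_exp (- 1 :: real)"
  have "(\<Sum>z\<in>S. fps_const (K x z - id_mat x z) * (?e * exp_fps S K z y))
      = (\<Sum>z\<in>S. ?e * (fps_const (K x z) * exp_fps S K z y)
               - (if x = z then 1 else 0) * (?e * exp_fps S K z y))"
    by (intro sum.cong) (auto simp: id_mat_def algebra_simps simp flip: fps_const_sub)
  also have "\<dots> = ?e * fps_deriv (exp_fps S K x y) - ?e * exp_fps S K x y"
    by (simp only: sum_subtractf sum_id_mat_mult[OF \<open>finite S\<close> x] fps_deriv_exp_fps sum_distrib_left)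
  also have "\<dots> = fps_deriv (?e * exp_fps S K x y)"
    by (simp add: fps_exp_deriv flip: fps_const_neg)
  finally show "fps_deriv (?e * exp_fps S K x y)
      = (\<Sum>z\<in>S. fps_const (K x z - id_mat x z) * (?e * exp_fps S K z y))" by simp
qed (use assms in \<open>auto simp: exp_fps_nth_0\<close>)

text \<open>Continuous time is discrete time observed after a Poisson number of steps.\<close>

lemma heat_kernel_poisson:
  assumes "finite S" "x \<in> S"
  shows "(\<lambda>k. exp (- t) * (t ^ k / fact k) * mat_pow S K k x y) sums heat_kernel S K t x y"
proof -
  have r: "fps_conv_radius (exp_fps S K x y) = \<infinity>" by (rule exp_fps_conv_radius[OF assms])
  have "heat_kernel S K t x y = exp (- t) * eval_fps (exp_fps S K x y) t"
    unfolding heat_kernel_eq_eval_fps exp_fps_diff_id[OF assms]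
    by (subst eval_fps_mult) (auto simp: r)
  moreover have "(\<lambda>k. fps_nth (exp_fps S K x y) k * t ^ k) sums eval_fps (exp_fps S K x y) t"
    using r by (intro sums_eval_fps) auto
  ultimately show ?thesis
    using sums_mult[of _ _ "exp (- t)"] by (fastforce simp: exp_fps_def mult_ac)
qed

section \<open>The heat kernel of a product chain\<close>

lemma fps_deriv_prod:
  assumes "finite I"
  shows "fps_deriv (\<Prod>i\<in>I. f i) = (\<Sum>i\<in>I. fps_deriv (f i) * (\<Prod>j\<in>I - {i}. f j :: 'a :: comm_ring_1 fps))"
  using assms
proof (induction I rule: finite_induct)
  case (insert k I)
  have *: "insert k I - {i} = insert k (I - {i})" if "i \<in> I" for i using that insert by auto
  have "(\<Sum>i\<in>I. fps_deriv (f i) * (\<Prod>j\<in>insert k I - {i}. f j))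
      = f k * (\<Sum>i\<in>I. fps_deriv (f i) * (\<Prod>j\<in>I - {i}. f j))"
    unfolding sum_distrib_left using insert by (intro sum.cong) (auto simp: * mult_ac)
  then show ?case using insert by (simp add: algebra_simps)
qed simp

lemma eval_fps_prod:
  fixes f :: "'i \<Rightarrow> real fps"
  assumes "finite I" "\<And>i. i \<in> I \<Longrightarrow> fps_conv_radius (f i) = \<infinity>"
  shows "eval_fps (\<Prod>i\<in>I. f i) t = (\<Prod>i\<in>I. eval_fps (f i) t)"
proof -
  have "fps_conv_radius (\<Prod>i\<in>I. f i) = \<infinity> \<and> eval_fps (\<Prod>i\<in>I. f i) t = (\<Prod>i\<in>I. eval_fps (f i) t)"
    using assms
  proof (induction I rule: finite_induct)
    case (insert k I)
    then have r: "fps_conv_radius (f k) = \<infinity>" "fps_conv_radius (\<Prod>i\<in>I. f i) = \<infinity>" by auto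
    have "fps_conv_radius (f k * (\<Prod>i\<in>I. f i)) = \<infinity>"
      using fps_conv_radius_mult[of "f k" "\<Prod>i\<in>I. f i"] r by simp
    then show ?case using insert r by (simp add: eval_fps_mult)
  qed simp
  then show ?thesis ..
qed

lemma tensor_id:
  assumes "finite I" "x \<in> Pi\<^sub>E I S" "y \<in> Pi\<^sub>E I S"
  shows "tensor I (\<lambda>_. id_mat) x y = id_mat x y"
proof (cases "x = y")
  case True
  then show ?thesis by (simp add: tensor_def id_mat_def)
next
  case False
  then obtain i where "i \<in> I" "x i \<noteq> y i" using assms by (meson PiE_ext)
  then show ?thesis using assms False by (auto simp: tensor_def id_mat_def)
qed

text \<open>The \<open>i\<close>-th summand of the product kernel acts on the \<open>i\<close>-th factor of a product function only.\<close>

lemma sum_tensor_update: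
  fixes g :: "'i \<Rightarrow> 'a \<Rightarrow> real fps"
  assumes "finite I" "\<And>j. j \<in> I \<Longrightarrow> finite (S j)" "i \<in> I" "x \<in> Pi\<^sub>E I S"
  shows "(\<Sum>z\<in>Pi\<^sub>E I S. fps_const (tensor I ((\<lambda>j. id_mat)(i := M)) x z) * (\<Prod>j\<in>I. g j (z j)))
       = (\<Sum>u\<in>S i. fps_const (M (x i) u) * g i u) * (\<Prod>j\<in>I - {i}. g j (x j))"
proof -
  let ?N = "(\<lambda>j. id_mat)(i := M)"
  have "fps_const (tensor I ?N x z) = (\<Prod>j\<in>I. fps_const (?N j (x j) (z j)))" for z
    unfolding tensor_def using \<open>finite I\<close> by (induction I rule: finite_induct) (auto simp flip: fps_const_mult)
  then have "(\<Sum>z\<in>Pi\<^sub>E I S. fps_const (tensor I ?N x z) * (\<Prod>j\<in>I. g j (z j)))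
      = (\<Sum>z\<in>Pi\<^sub>E I S. \<Prod>j\<in>I. fps_const (?N j (x j) (z j)) * g j (z j))"
    by (simp add: prod.distrib)
  also have "\<dots> = (\<Prod>j\<in>I. \<Sum>u\<in>S j. fps_const (?N j (x j) u) * g j u)"
    using assms by (intro prod_sum_PiE[symmetric]) auto
  also have "\<dots> = (\<Sum>u\<in>S i. fps_const (M (x i) u) * g i u)
      * (\<Prod>j\<in>I - {i}. \<Sum>u\<in>S j. fps_const (?N j (x j) u) * g j u)"
    using assms by (subst prod.remove[of I i]) auto
  also have "(\<Prod>j\<in>I - {i}. \<Sum>u\<in>S j. fps_const (?N j (x j) u) * g j u) = (\<Prod>j\<in>I - {i}. g j (x j))"
  proof (rule prod.cong[OF refl])
    fix j assume j: "j \<in> I - {i}"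
    then have "(\<Sum>u\<in>S j. fps_const (?N j (x j) u) * g j u)
        = (\<Sum>u\<in>S j. (if x j = u then 1 else 0) * g j u)"
      by (intro sum.cong) (auto simp: id_mat_def)
    also have "\<dots> = g j (x j)" using assms j by (intro sum_id_mat_mult) auto
    finally show "(\<Sum>u\<in>S j. fps_const (?N j (x j) u) * g j u) = g j (x j)" .
  qed
  finally show ?thesis .
qed

text \<open>By the product rule the product of the exponentials of the coordinates solves the differential
equation of the product chain.  The condition that the weights sum to \<open>1\<close> distributes the identity
matrix of the generator over the coordinates.\<close>

lemma exp_fps_product:
  fixes S :: "'i \<Rightarrow> 'a set" and K :: "'i \<Rightarrow> 'a kernel"
  assumes fin: "finite I" "\<And>i. i \<in> I \<Longrightarrow> finite (S i)" and w: "(\<Sum>i\<in>I. w i) = 1"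
    and y: "y \<in> Pi\<^sub>E I S" and x: "x \<in> Pi\<^sub>E I S"
  shows "exp_fps (Pi\<^sub>E I S) (\<lambda>x y. product_kernel I w K x y - id_mat x y) x y
       = (\<Prod>i\<in>I. exp_fps (S i) (\<lambda>u v. w i * (K i u v - id_mat u v)) (x i) (y i))"
proof -
  define g where "g i u = exp_fps (S i) (\<lambda>u v. w i * (K i u v - id_mat u v)) u (y i)" for i u
  define P where "P x = (\<Prod>i\<in>I. g i (x i))" for x
  have "P x = exp_fps (Pi\<^sub>E I S) (\<lambda>x y. product_kernel I w K x y - id_mat x y) x y"
  proof (rule exp_fps_unique[OF _ _ x])
    fix x assume x: "x \<in> Pi\<^sub>E I S"
    have "fps_nth (P x) 0 = (\<Prod>i\<in>I. fps_nth (g i (x i)) 0)"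
      unfolding P_def using fin(1) by (induction I rule: finite_induct) auto
    then show "fps_nth (P x) 0 = id_mat x y"
      using tensor_id[OF fin(1) x y] by (simp add: g_def exp_fps_nth_0 tensor_def)
    have split: "product_kernel I w K x z - id_mat x z
        = (\<Sum>i\<in>I. w i * (tensor I ((\<lambda>j. id_mat)(i := K i)) x z - tensor I ((\<lambda>j. id_mat)(i := id_mat)) x z))"
      if "z \<in> Pi\<^sub>E I S" for z
    proof -
      have "(\<lambda>j. id_mat)(i := id_mat) = (\<lambda>_. id_mat :: 'a kernel)" for i :: 'i by auto
      then show ?thesis using tensor_id[OF fin(1) x that] w
        by (simp add: product_kernel_def right_diff_distrib sum_subtractf flip: sum_distrib_right)
    qed
    have "(\<Sum>z\<in>Pi\<^sub>E I S. fps_const (product_kernel I w K x z - id_mat x z) * P z)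
        = (\<Sum>i\<in>I. fps_const (w i) *
            ((\<Sum>z\<in>Pi\<^sub>E I S. fps_const (tensor I ((\<lambda>j. id_mat)(i := K i)) x z) * (\<Prod>j\<in>I. g j (z j)))
           - (\<Sum>z\<in>Pi\<^sub>E I S. fps_const (tensor I ((\<lambda>j. id_mat)(i := id_mat)) x z) * (\<Prod>j\<in>I. g j (z j)))))"
    proof -
      have "fps_const (product_kernel I w K x z - id_mat x z) * P z
          = (\<Sum>i\<in>I. fps_const (w i) *
            (fps_const (tensor I ((\<lambda>j. id_mat)(i := K i)) x z) * P z
             - fps_const (tensor I ((\<lambda>j. id_mat)(i := id_mat)) x z) * P z))"
        if "z \<in> Pi\<^sub>E I S" for z
      proof -
        have s: "fps_const (\<Sum>i\<in>I. f i) = (\<Sum>i\<in>I. fps_const (f i))" for f :: "'i \<Rightarrow> real"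
          by (rule fps_ext) (simp add: fps_sum_nth)
        show ?thesis unfolding split[OF that] s sum_distrib_right
          by (intro sum.cong) (auto simp: algebra_simps simp flip: fps_const_mult fps_const_sub)
      qed
      then show ?thesis
        unfolding P_def[symmetric] sum_subtractf[symmetric] sum_distrib_left
        by (subst sum.swap) (rule sum.cong, auto)
    qed
    also have "\<dots> = (\<Sum>i\<in>I. fps_const (w i) *
            ((\<Sum>u\<in>S i. fps_const (K i (x i) u) * g i u) * (\<Prod>j\<in>I - {i}. g j (x j))
           - (\<Sum>u\<in>S i. fps_const (id_mat (x i) u) * g i u) * (\<Prod>j\<in>I - {i}. g j (x j))))"
      using fin x by (intro sum.cong refl) (simp only: sum_tensor_update)
    also have "\<dots> = (\<Sum>i\<in>I. fps_deriv (g i (x i)) * (\<Prod>j\<in>I - {i}. g j (x j)))"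
    proof (rule sum.cong[OF refl])
      fix i assume "i \<in> I"
      have "fps_deriv (g i (x i))
          = fps_const (w i) * ((\<Sum>u\<in>S i. fps_const (K i (x i) u) * g i u)
             - (\<Sum>u\<in>S i. fps_const (id_mat (x i) u) * g i u))"
        unfolding g_def fps_deriv_exp_fps sum_subtractf[symmetric] sum_distrib_left
        by (intro sum.cong) (auto simp: algebra_simps simp flip: fps_const_mult fps_const_sub)
      then show "fps_const (w i) *
            ((\<Sum>u\<in>S i. fps_const (K i (x i) u) * g i u) * (\<Prod>j\<in>I - {i}. g j (x j))
           - (\<Sum>u\<in>S i. fps_const (id_mat (x i) u) * g i u) * (\<Prod>j\<in>I - {i}. g j (x j)))
          = fps_deriv (g i (x i)) * (\<Prod>j\<in>I - {i}. g j (x j))"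
        by (simp only: left_diff_distrib mult.assoc)
    qed
    also have "\<dots> = fps_deriv (P x)" unfolding P_def by (rule fps_deriv_prod[OF fin(1), symmetric])
    finally show "fps_deriv (P x)
        = (\<Sum>z\<in>Pi\<^sub>E I S. fps_const (product_kernel I w K x z - id_mat x z) * P z)" by simp
  qed
  then show ?thesis by (simp add: P_def g_def)
qed

lemma heat_kernel_product:
  assumes fin: "finite I" "\<And>i. i \<in> I \<Longrightarrow> finite (S i)" and w: "(\<Sum>i\<in>I. w i) = 1"
    and x: "x \<in> Pi\<^sub>E I S" and y: "y \<in> Pi\<^sub>E I S"
  shows "heat_kernel (Pi\<^sub>E I S) (product_kernel I w K) t x y
       = (\<Prod>i\<in>I. heat_kernel (S i) (K i) (t * w i) (x i) (y i))"
proof -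
  have "heat_kernel (Pi\<^sub>E I S) (product_kernel I w K) t x y
      = (\<Prod>i\<in>I. eval_fps (exp_fps (S i) (\<lambda>u v. w i * (K i u v - id_mat u v)) (x i) (y i)) t)"
    using fin x exp_fps_product[OF fin w y x, of K] unfolding heat_kernel_eq_eval_fps
    by (auto simp: eval_fps_prod exp_fps_conv_radius PiE_mem)
  also have "\<dots> = (\<Prod>i\<in>I. heat_kernel (S i) (K i) (t * w i) (x i) (y i))"
    unfolding heat_kernel_eq_eval_fps mat_exp_scale_eq_eval_fps[symmetric]
    by (simp add: mult.assoc)
  finally show ?thesis .
qed

section \<open>Stochastic kernels and total variation\<close>

lemma
  assumes "stochastic S K" "x \<in> S"
  shows stochastic_nonneg: "y \<in> S \<Longrightarrow> 0 \<le> K x y"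
    and stochastic_row_sum: "(\<Sum>y\<in>S. K x y) = 1"
  using assms by (auto simp: stochastic_def)

lemma stochastic_mat_pow:
  assumes "finite S" "stochastic S K"
  shows "stochastic S (mat_pow S K k)"
proof (induction k)
  case 0
  show ?case using assms by (auto simp: stochastic_def id_mat_def)
next
  case (Suc k)
  have "(\<Sum>y\<in>S. \<Sum>z\<in>S. K x z * mat_pow S K k z y) = 1" if "x \<in> S" for x
  proof -
    have "(\<Sum>y\<in>S. \<Sum>z\<in>S. K x z * mat_pow S K k z y)
        = (\<Sum>z\<in>S. K x z * (\<Sum>y\<in>S. mat_pow S K k z y))"
      by (subst sum.swap) (simp add: sum_distrib_left)
    then show ?thesis using Suc assms that by (simp add: stochastic_def)
  qed
  then show ?case using Suc assms by (auto simp: stochastic_def intro!: sum_nonneg)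
qed

lemma stochastic_le_1:
  assumes "finite S" "stochastic S K" "x \<in> S" "y \<in> S"
  shows "K x y \<le> 1"
  using assms member_le_sum[of y S "K x"] by (auto simp: stochastic_def)

lemma poisson_sums: "(\<lambda>k. exp (- t) * (t ^ k / fact k)) sums (1 :: real)"
proof -
  have "(\<lambda>k. t ^ k / fact k) sums exp t" using exp_converges[of t] by (simp add: field_simps)
  then have "(\<lambda>k. exp (- t) * (t ^ k / fact k)) sums (exp (- t) * exp t)" by (rule sums_mult)
  then show ?thesis by (simp flip: exp_add)
qed

lemma stochastic_heat_kernel:
  assumes "finite S" "stochastic S K" "0 \<le> t"
  shows "stochastic S (heat_kernel S K t)"
  unfolding stochastic_def
proof (intro conjI ballI)
  fix x y assume "x \<in> S" "y \<in> S"
  then show "0 \<le> heat_kernel S K t x y"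
    using stochastic_mat_pow[OF assms(1,2)] \<open>0 \<le> t\<close>
    by (intro sums_le[OF _ sums_zero heat_kernel_poisson[OF assms(1) \<open>x \<in> S\<close>]])
       (auto simp: stochastic_def)
next
  fix x assume x: "x \<in> S"
  have "(\<lambda>k. \<Sum>y\<in>S. exp (- t) * (t ^ k / fact k) * mat_pow S K k x y)
      sums (\<Sum>y\<in>S. heat_kernel S K t x y)"
    by (intro sums_sum heat_kernel_poisson[OF assms(1) x])
  moreover have "(\<Sum>y\<in>S. exp (- t) * (t ^ k / fact k) * mat_pow S K k x y)
      = exp (- t) * (t ^ k / fact k)" for k
    using stochastic_row_sum[OF stochastic_mat_pow[OF assms(1,2)] x, of k]
    by (simp only: mult_1_right flip: sum_distrib_left)
  ultimately show "(\<Sum>y\<in>S. heat_kernel S K t x y) = 1"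
    using poisson_sums[of t] sums_unique2 by fastforce
qed

lemma stochastic_heat_kernel_product:
  assumes fin: "finite I" "\<And>i. i \<in> I \<Longrightarrow> finite (S i)" and w: "(\<Sum>i\<in>I. w i) = 1"
    and w_nonneg: "\<And>i. i \<in> I \<Longrightarrow> 0 \<le> w i"
    and K: "\<And>i. i \<in> I \<Longrightarrow> stochastic (S i) (K i)" and "0 \<le> t"
  shows "stochastic (Pi\<^sub>E I S) (heat_kernel (Pi\<^sub>E I S) (product_kernel I w K) t)"
proof -
  have st: "stochastic (S i) (heat_kernel (S i) (K i) (t * w i))" if "i \<in> I" for i
    using that assms by (intro stochastic_heat_kernel) auto
  note prod = heat_kernel_product[OF fin w]
  show ?thesis
    unfolding stochastic_def
  proof (intro conjI ballI)
    fix x y assume xy: "x \<in> Pi\<^sub>E I S" "y \<in> Pi\<^sub>E I S"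
    have "0 \<le> (\<Prod>i\<in>I. heat_kernel (S i) (K i) (t * w i) (x i) (y i))"
      using xy by (intro prod_nonneg ballI stochastic_nonneg[OF st]) auto
    then show "0 \<le> heat_kernel (Pi\<^sub>E I S) (product_kernel I w K) t x y"
      using prod[OF _ xy] by simp
  next
    fix x assume x: "x \<in> Pi\<^sub>E I S"
    have "(\<Sum>y\<in>Pi\<^sub>E I S. heat_kernel (Pi\<^sub>E I S) (product_kernel I w K) t x y)
        = (\<Sum>y\<in>Pi\<^sub>E I S. \<Prod>i\<in>I. heat_kernel (S i) (K i) (t * w i) (x i) (y i))"
      using prod[OF _ x] by (intro sum.cong) auto
    also have "\<dots> = (\<Prod>i\<in>I. \<Sum>u\<in>S i. heat_kernel (S i) (K i) (t * w i) (x i) u)"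
      using fin by (intro prod_sum_PiE[symmetric]) auto
    also have "\<dots> = (\<Prod>i\<in>I. 1)"
      using x by (intro prod.cong refl stochastic_row_sum[OF st]) auto
    finally show "(\<Sum>y\<in>Pi\<^sub>E I S. heat_kernel (Pi\<^sub>E I S) (product_kernel I w K) t x y) = 1" by simp
  qed
qed

text \<open>The two bounds by a single state \<open>z\<close> are sharp when \<open>\<pi>\<close> is nearly the point mass at \<open>z\<close>: test with
the complement of \<open>z\<close> for the lower one, and distinguish whether the test set contains \<open>z\<close> for the
upper one.\<close>

lemma
  assumes fin: "finite S" and H: "stochastic S (heat_kernel S K t)"
    and \<pi>: "\<And>x. x \<in> S \<Longrightarrow> 0 \<le> \<pi> x" "(\<Sum>x\<in>S. \<pi> x) = 1" and z: "z \<in> S"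
  shows tv_distance_c_nonneg: "0 \<le> tv_distance_c S K \<pi> t"
    and tv_distance_c_le_1: "tv_distance_c S K \<pi> t \<le> 1"
    and tv_distance_c_ge_point: "x \<in> S \<Longrightarrow> \<pi> z - heat_kernel S K t x z \<le> tv_distance_c S K \<pi> t"
    and tv_distance_c_le_point:
      "(\<And>x. x \<in> S \<Longrightarrow> v \<le> heat_kernel S K t x z) \<Longrightarrow> tv_distance_c S K \<pi> t \<le> (1 - \<pi> z) + (1 - v)"
proof -
  let ?H = "heat_kernel S K t"
  let ?D = "{(\<Sum>y\<in>A. ?H x y) - (\<Sum>y\<in>A. \<pi> y) | x A. x \<in> S \<and> A \<subseteq> S}"
  have le1: "(\<Sum>y\<in>A. ?H x y) \<le> 1" if "x \<in> S" "A \<subseteq> S" for x A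
    using sum_mono2[OF fin that(2), of "?H x"] H that by (auto simp: stochastic_def)
  have nn: "0 \<le> (\<Sum>y\<in>A. \<pi> y)" if "A \<subseteq> S" for A using that \<pi> by (auto intro!: sum_nonneg)
  have D_le1: "d \<le> 1" if "d \<in> ?D" for d
  proof -
    from that obtain x A where "d = (\<Sum>y\<in>A. ?H x y) - (\<Sum>y\<in>A. \<pi> y)" "x \<in> S" "A \<subseteq> S" by blast
    then show "d \<le> 1" using le1[of x A] nn[of A] by linarith
  qed
  have "0 \<in> ?D" using z by (auto intro!: exI[of _ z] exI[of _ "{}"])
  then show "0 \<le> tv_distance_c S K \<pi> t" "tv_distance_c S K \<pi> t \<le> 1"
    unfolding tv_distance_c_def using D_le1
    by (auto intro!: cSup_upper bdd_aboveI[of _ 1] cSup_least simp del: mem_Collect_eq)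
  show "\<pi> z - ?H x z \<le> tv_distance_c S K \<pi> t" if x: "x \<in> S"
    unfolding tv_distance_c_def
  proof (rule cSup_upper)
    have "(\<Sum>y\<in>S - {z}. ?H x y) = 1 - ?H x z" "(\<Sum>y\<in>S - {z}. \<pi> y) = 1 - \<pi> z"
      using fin z x H \<pi> by (auto simp: sum_diff1 stochastic_def)
    then have "\<pi> z - ?H x z = (\<Sum>y\<in>S - {z}. ?H x y) - (\<Sum>y\<in>S - {z}. \<pi> y)" by simp
    then show "\<pi> z - ?H x z \<in> ?D" using x by blast
    show "bdd_above ?D"
      by (rule bdd_aboveI[of _ 1]) (rule D_le1)
  qed
  show "tv_distance_c S K \<pi> t \<le> (1 - \<pi> z) + (1 - v)"
    if v: "\<And>x. x \<in> S \<Longrightarrow> v \<le> ?H x z"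
    unfolding tv_distance_c_def
  proof (rule cSup_least)
    show "?D \<noteq> {}" using z by blast
    fix d assume "d \<in> ?D"
    then obtain x A where d: "d = (\<Sum>y\<in>A. ?H x y) - (\<Sum>y\<in>A. \<pi> y)" "x \<in> S" "A \<subseteq> S" by blast
    have v1: "v \<le> 1" using v[OF z] stochastic_le_1[OF fin H z z] by simp
    have \<pi>1: "\<pi> z \<le> 1" using member_le_sum[of z S \<pi>] z fin \<pi> by auto
    have finA: "finite A" using d fin finite_subset by auto
    show "d \<le> (1 - \<pi> z) + (1 - v)"
    proof (cases "z \<in> A")
      case True
      have "\<pi> z \<le> (\<Sum>y\<in>A. \<pi> y)" using True finA d \<pi> by (intro member_le_sum) auto
      then show ?thesis using d le1[of x A] v1 by linarith
    next
      case False
      have "(\<Sum>y\<in>A. ?H x y) \<le> (\<Sum>y\<in>S - {z}. ?H x y)"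
        using False d fin H by (intro sum_mono2) (auto simp: stochastic_def)
      also have "\<dots> = 1 - ?H x z" using fin z d H by (auto simp: sum_diff1 stochastic_def)
      finally show ?thesis using d nn[of A] v[of x] \<pi>1 by linarith
    qed
  qed
qed

text \<open>The minimum over \<open>x\<close> of \<open>K ^ k x z\<close> is nondecreasing in \<open>k\<close>, because a step from \<open>x\<close> averages over
starting states.  This makes arrival estimates for one time valid for all later times.\<close>

lemma mat_pow_lower_bound_persists:
  assumes "finite S" "stochastic S K" "\<And>x. x \<in> S \<Longrightarrow> v \<le> mat_pow S K m x z" "m \<le> k" "x \<in> S"
  shows "v \<le> mat_pow S K k x z"
  using assms(4,5)
proof (induction k arbitrary: x rule: dec_induct)
  case base
  then show ?case using assms by blast
next
  case (step k)
  have "v = (\<Sum>y\<in>S. K x y * v)"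
    using assms step.prems by (simp add: stochastic_def flip: sum_distrib_right)
  also have "\<dots> \<le> (\<Sum>y\<in>S. K x y * mat_pow S K k y z)"
    using step assms by (intro sum_mono mult_left_mono) (auto simp: stochastic_def)
  finally show ?case by simp
qed

lemma stationary_mat_pow:
  assumes "finite S" "stationary_distribution S K \<pi>" "y \<in> S"
  shows "(\<Sum>x\<in>S. \<pi> x * mat_pow S K k x y) = \<pi> y"
proof (induction k)
  case 0
  have "(\<Sum>x\<in>S. \<pi> x * id_mat x y) = (\<Sum>x\<in>S. if x = y then \<pi> x else 0)"
    by (intro sum.cong) (auto simp: id_mat_def)
  then show ?case using assms by simp
next
  case (Suc k)
  have "(\<Sum>x\<in>S. \<pi> x * mat_pow S K (Suc k) x y) = (\<Sum>z\<in>S. (\<Sum>x\<in>S. \<pi> x * K x z) * mat_pow S K k z y)"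
    by (simp add: sum_distrib_left sum_distrib_right mult.assoc) (rule sum.swap)
  then show ?case using Suc assms by (simp add: stationary_distribution_def)
qed

lemma stationary_lower_bound:
  assumes "finite S" "stationary_distribution S K \<pi>" "z \<in> S"
    and "\<And>x. x \<in> S \<Longrightarrow> v \<le> mat_pow S K m x z"
  shows "v \<le> \<pi> z"
proof -
  have "v = (\<Sum>x\<in>S. \<pi> x * v)"
    using assms by (simp add: stationary_distribution_def flip: sum_distrib_right)
  also have "\<dots> \<le> (\<Sum>x\<in>S. \<pi> x * mat_pow S K m x z)"
    using assms by (intro sum_mono mult_left_mono) (auto simp: stationary_distribution_def)
  finally show ?thesis using stationary_mat_pow[OF assms(1,2,3)] by simp
qed

section \<open>Poisson clocks\<close>

text \<open>The probability that a Poisson variable with mean \<open>s\<close> is smaller than \<open>m\<close>.\<close>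

definition poisson_below :: "nat \<Rightarrow> real \<Rightarrow> real" where
  "poisson_below m s = (\<Sum>k<m. exp (- s) * (s ^ k / fact k))"

lemma poisson_below_nonneg: "0 \<le> s \<Longrightarrow> 0 \<le> poisson_below m s"
  by (auto simp: poisson_below_def intro!: sum_nonneg)

lemma poisson_below_sums:
  "(\<lambda>k. exp (- s) * (s ^ k / fact k) * (if k < m then u else v)) sums (u * poisson_below m s + v * (1 - poisson_below m s))"
proof -
  have "(\<lambda>k. if k \<in> {..<m} then exp (- s) * (s ^ k / fact k) else 0) sums poisson_below m s"
    unfolding poisson_below_def by (rule sums_If_finite_set) simp
  then have "(\<lambda>k. (u - v) * (if k \<in> {..<m} then exp (- s) * (s ^ k / fact k) else 0)
        + v * (exp (- s) * (s ^ k / fact k))) sums ((u - v) * poisson_below m s + v * 1)"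
    by (intro sums_add sums_mult poisson_sums)
  moreover have "(\<lambda>k. (u - v) * (if k \<in> {..<m} then exp (- s) * (s ^ k / fact k) else 0)
        + v * (exp (- s) * (s ^ k / fact k)))
      = (\<lambda>k. exp (- s) * (s ^ k / fact k) * (if k < m then u else v))"
    by (auto simp: algebra_simps)
  moreover have "(u - v) * poisson_below m s + v * 1
      = u * poisson_below m s + v * (1 - poisson_below m s)" by (simp add: algebra_simps)
  ultimately show ?thesis by simp
qed

text \<open>Chernoff's bound for the lower tail, with the exponential parameter chosen as \<open>ln (1 + \<epsilon>)\<close>.\<close>

lemma poisson_below_upper:
  assumes "0 < \<epsilon>" "(1 + \<epsilon>) * real m \<le> s"
  shows "poisson_below m s \<le> ((1 + \<epsilon>) * exp (- \<epsilon>)) ^ m"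
proof -
  define r where "r = 1 + \<epsilon>"
  have r: "1 < r" and mr: "real m \<le> s / r"
    using assms by (auto simp: r_def field_simps)
  have s: "0 \<le> s" using assms by (smt (verit) mult_nonneg_nonneg of_nat_0_le_iff)
  have "(\<Sum>k<m. s ^ k / fact k) \<le> (\<Sum>k<m. r ^ m * ((s / r) ^ k / fact k))"
  proof (rule sum_mono)
    fix k assume "k \<in> {..<m}"
    then have "r ^ k \<le> r ^ m" using r by (intro power_increasing) auto
    then have "(s / r) ^ k * r ^ k \<le> (s / r) ^ k * r ^ m"
      using r s by (intro mult_left_mono) auto
    then have "s ^ k \<le> r ^ m * (s / r) ^ k" using r by (simp add: power_divide mult_ac)
    then show "s ^ k / fact k \<le> r ^ m * ((s / r) ^ k / fact k)" by (simp add: divide_right_mono)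
  qed
  also have "\<dots> = r ^ m * (\<Sum>k<m. (s / r) ^ k / fact k)" by (simp add: sum_distrib_left)
  also have "(\<Sum>k<m. (s / r) ^ k / fact k) \<le> exp (s / r)"
  proof -
    have "(\<lambda>k. (s / r) ^ k / fact k) sums exp (s / r)"
      using exp_converges[of "s / r"] by (simp add: field_simps)
    then show ?thesis using s r by (intro sum_le_suminf[of _ "{..<m}", THEN order.trans]) (auto simp: sums_iff)
  qed
  finally have "(\<Sum>k<m. s ^ k / fact k) \<le> r ^ m * exp (s / r)" using r by simp
  then have "poisson_below m s \<le> exp (- s) * (r ^ m * exp (s / r))"
    unfolding poisson_below_def by (simp only: sum_distrib_left[symmetric] mult_left_mono exp_ge_zero)
  also have "\<dots> = r ^ m * exp (- \<epsilon> * (s / r))"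
    using r by (simp add: r_def field_simps flip: exp_add)
  also have "\<dots> \<le> r ^ m * exp (- \<epsilon> * real m)"
    using r assms mult_left_mono[OF mr, of \<epsilon>] by (intro mult_left_mono) auto
  also have "\<dots> = ((1 + \<epsilon>) * exp (- \<epsilon>)) ^ m"
    by (simp add: r_def power_mult_distrib mult.commute flip: exp_of_nat_mult)
  finally show ?thesis .
qed

text \<open>Chernoff's bound for the upper tail, with the exponential parameter \<open>- ln (1 - \<epsilon>)\<close>.\<close>

lemma poisson_below_lower:
  assumes "0 < \<epsilon>" "\<epsilon> < 1" "0 \<le> s" "s \<le> (1 - \<epsilon>) * real m"
  shows "1 - ((1 - \<epsilon>) * exp \<epsilon>) ^ m \<le> poisson_below m s"
proof -
  define r where "r = 1 - \<epsilon>"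
  have r: "0 < r" "r < 1" and mr: "s / r \<le> real m"
    using assms by (auto simp: r_def field_simps)
  have "1 - poisson_below m s \<le> exp (- s) * (r ^ m * exp (s / r))"
  proof (rule sums_le)
    show "(\<lambda>k. exp (- s) * (s ^ k / fact k) * (if k < m then 0 else 1)) sums (1 - poisson_below m s)"
      using poisson_below_sums[of s m 0 1] by simp
    show "(\<lambda>k. exp (- s) * (r ^ m * ((s / r) ^ k / fact k))) sums (exp (- s) * (r ^ m * exp (s / r)))"
      using exp_converges[of "s / r"] by (intro sums_mult) (simp add: field_simps)
    fix k
    show "exp (- s) * (s ^ k / fact k) * (if k < m then 0 else 1)
        \<le> exp (- s) * (r ^ m * ((s / r) ^ k / fact k))"
    proof (cases "k < m")
      case False
      then have "r ^ k \<le> r ^ m" using r by (intro power_decreasing) auto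
      then have "(s / r) ^ k * r ^ k \<le> (s / r) ^ k * r ^ m"
        using r assms by (intro mult_left_mono) auto
      then have "s ^ k \<le> r ^ m * (s / r) ^ k" using r by (simp add: power_divide mult_ac)
      then show ?thesis using False by (simp add: divide_right_mono)
    qed (use r assms in auto)
  qed
  also have "\<dots> = r ^ m * exp (\<epsilon> * (s / r))"
    using r by (simp add: r_def field_simps flip: exp_add)
  also have "\<dots> \<le> r ^ m * exp (\<epsilon> * real m)"
    using r assms mult_left_mono[OF mr, of \<epsilon>] by (intro mult_left_mono) auto
  also have "\<dots> = ((1 - \<epsilon>) * exp \<epsilon>) ^ m"
    by (simp add: r_def power_mult_distrib mult.commute flip: exp_of_nat_mult)
  finally show ?thesis by simp
qed

lemma heat_kernel_ge_of_late:
  assumes "finite S" "stochastic S K" "0 \<le> t" "x \<in> S" "z \<in> S"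
    and "\<And>k. m \<le> k \<Longrightarrow> v \<le> mat_pow S K k x z"
  shows "v * (1 - poisson_below m t) \<le> heat_kernel S K t x z"
proof -
  have "0 * poisson_below m t + v * (1 - poisson_below m t) \<le> heat_kernel S K t x z"
    using stochastic_nonneg[OF stochastic_mat_pow[OF assms(1,2)]] assms
    by (intro sums_le[OF _ poisson_below_sums heat_kernel_poisson[OF assms(1,4)]] mult_left_mono) auto
  then show ?thesis by simp
qed

lemma heat_kernel_le_of_early:
  assumes "finite S" "stochastic S K" "0 \<le> t" "x \<in> S" "z \<in> S"
    and "\<And>k. k < m \<Longrightarrow> mat_pow S K k x z \<le> v"
  shows "heat_kernel S K t x z \<le> 1 - (1 - v) * poisson_below m t"
proof -
  have "heat_kernel S K t x z \<le> v * poisson_below m t + 1 * (1 - poisson_below m t)"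
    using stochastic_le_1[OF assms(1) stochastic_mat_pow[OF assms(1,2)]] assms
    by (intro sums_le[OF _ heat_kernel_poisson[OF assms(1,4)] poisson_below_sums] mult_left_mono) auto
  then show ?thesis by (simp add: algebra_simps)
qed

section \<open>The chain with a shortcut\<close>

lemma mat_pow_Suc_ge_one:
  assumes "finite S" "stochastic S K" "x \<in> S" "z \<in> S" "y \<in> S"
  shows "K x z * mat_pow S K k z y \<le> mat_pow S K (Suc k) x y"
  using assms stochastic_mat_pow[OF assms(1,2), of k]
  by (auto simp: stochastic_def intro!: member_le_sum[of z S "\<lambda>z. K x z * mat_pow S K k z y"])

lemma mat_pow_Suc_ge_two:
  assumes "finite S" "stochastic S K" "x \<in> S" "z \<in> S" "z' \<in> S" "z \<noteq> z'" "y \<in> S"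
  shows "K x z * mat_pow S K k z y + K x z' * mat_pow S K k z' y \<le> mat_pow S K (Suc k) x y"
proof -
  have "(\<Sum>w\<in>{z, z'}. K x w * mat_pow S K k w y) \<le> (\<Sum>w\<in>S. K x w * mat_pow S K k w y)"
    using assms stochastic_mat_pow[OF assms(1,2), of k] by (intro sum_mono2) (auto simp: stochastic_def)
  then show ?thesis using assms by simp
qed

text \<open>Here \<open>\<eta>\<close> is the probability of missing the shortcut at \<open>n\<close>.\<close>

locale shortcut_chain =
  fixes \<beta> a b c :: real and n :: nat and \<eta> :: real and S :: "nat set" and K :: "nat kernel"
  defines "\<eta> \<equiv> b * real n powr (- \<beta>)"
    and "S \<equiv> {0..2 * n}"
    and "K \<equiv> shortcut_kernel \<beta> n a b c"
  assumes n: "2 \<le> n" and stoch: "stochastic S K"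
begin

lemma finite_S: "finite S" by (simp add: S_def)

lemma entries:
  shows "x < n \<Longrightarrow> K x (Suc x) = 1 - a" "n < x \<Longrightarrow> x < 2 * n \<Longrightarrow> K x (Suc x) = 1 - a"
    and "K n (Suc n) = \<eta>" "K n (2 * n) = 1 - a - \<eta>"
    and "K (2 * n) n = c" "K (2 * n) (2 * n) = 1 - a - c" "K (Suc 0) 0 = a"
  using n by (auto simp: K_def \<eta>_def shortcut_kernel_def)

lemma params: "0 \<le> a" "0 \<le> c" "0 \<le> \<eta>" "a + c \<le> 1" "a + \<eta> \<le> 1"
proof -
  have "0 \<le> K x y" if "x \<le> 2 * n" "y \<le> 2 * n" for x y
    using stoch that by (auto simp: stochastic_def S_def)
  from this[of "Suc 0" 0] this[of "2 * n" n] this[of n "Suc n"] this[of "2 * n" "2 * n"] this[of n "2 * n"]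
  show "0 \<le> a" "0 \<le> c" "0 \<le> \<eta>" "a + c \<le> 1" "a + \<eta> \<le> 1"
    using n by (auto simp: entries)
qed

text \<open>The path that moves up at each step and then rests at \<open>2 n\<close> deviates with probability at most
\<open>a + c\<close> at each step.\<close>

lemma pow_from_upper_half:
  assumes "n < x" "x \<le> 2 * n" "2 * n \<le> x + k"
  shows "1 - real k * (a + c) \<le> mat_pow S K k x (2 * n)"
  using assms
proof (induction k arbitrary: x)
  case 0
  then show ?case by (simp add: id_mat_def)
next
  case (Suc k)
  define z where "z = (if x = 2 * n then 2 * n else Suc x)"
  have z: "n < z" "z \<le> 2 * n" "2 * n \<le> z + k" using Suc.prems by (auto simp: z_def)
  have Kz: "1 - (a + c) \<le> K x z" using Suc.prems params by (auto simp: z_def entries)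
  have "1 - real (Suc k) * (a + c) \<le> (1 - (a + c)) * (1 - real k * (a + c))"
    using params by (simp add: algebra_simps)
  also have "\<dots> \<le> (1 - (a + c)) * mat_pow S K k z (2 * n)"
    using Suc.IH[OF z] params by (intro mult_left_mono) auto
  also have "\<dots> \<le> K x z * mat_pow S K k z (2 * n)"
    using Kz stochastic_mat_pow[OF finite_S stoch, of k] z
    by (intro mult_right_mono) (auto simp: stochastic_def S_def)
  also have "\<dots> \<le> mat_pow S K (Suc k) x (2 * n)"
    using Suc.prems z by (intro mat_pow_Suc_ge_one[OF finite_S stoch]) (auto simp: S_def)
  finally show ?case .
qed

text \<open>The path through the shortcut.  Its \<open>\<eta>\<close> is paid once, at \<open>n\<close>, and so it is not multiplied by the
number of steps.\<close>

lemma pow_fast: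
  assumes "x \<le> n" "n + 1 \<le> x + k"
  shows "1 - \<eta> - real k * (a + c) \<le> mat_pow S K k x (2 * n)"
  using assms
proof (induction k arbitrary: x)
  case 0
  then show ?case by simp
next
  case (Suc k)
  define u where "u = real k * (a + c)"
  have u: "0 \<le> u" using params by (simp add: u_def)
  have goal: "1 - \<eta> - real (Suc k) * (a + c) \<le> 1 - \<eta> - a - u"
    using params by (simp add: u_def algebra_simps)
  show ?case
  proof (cases "x = n")
    case True
    have "1 - \<eta> - a - u \<le> (1 - a - \<eta>) * (1 - u)"
      using mult_nonneg_nonneg[OF u, of "a + \<eta>"] params by (simp add: algebra_simps)
    also have "\<dots> \<le> K n (2 * n) * mat_pow S K k (2 * n) (2 * n)"
      using pow_from_upper_half[of "2 * n" k] n params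
      by (auto simp: entries u_def intro!: mult_left_mono)
    also have "\<dots> \<le> mat_pow S K (Suc k) n (2 * n)"
      by (intro mat_pow_Suc_ge_one[OF finite_S stoch]) (auto simp: S_def)
    finally show ?thesis using goal True by simp
  next
    case False
    then have x: "x < n" using Suc.prems by simp
    have "1 - \<eta> - a - u \<le> (1 - a) * (1 - \<eta> - u)"
      using mult_nonneg_nonneg[OF params(1), of "\<eta> + u"] params u by (simp add: algebra_simps)
    also have "\<dots> \<le> K x (Suc x) * mat_pow S K k (Suc x) (2 * n)"
      using Suc.IH[of "Suc x"] Suc.prems x params
      by (auto simp: entries u_def intro!: mult_left_mono)
    also have "\<dots> \<le> mat_pow S K (Suc k) x (2 * n)"
      using x by (intro mat_pow_Suc_ge_one[OF finite_S stoch]) (auto simp: S_def)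
    finally show ?thesis using goal by simp
  qed
qed

text \<open>Both the shortcut and the long route lead to \<open>2 n\<close> within \<open>2 n\<close> steps, so here \<open>\<eta>\<close> is not lost.\<close>

lemma pow_slow:
  assumes "x \<le> 2 * n" "2 * n \<le> x + k"
  shows "1 - real k * (a + c) \<le> mat_pow S K k x (2 * n)"
proof (cases "n < x")
  case True
  then show ?thesis using assms pow_from_upper_half by blast
next
  case False
  then have "x \<le> n" by simp
  then show ?thesis using assms(2)
  proof (induction k arbitrary: x)
    case 0
    then show ?case using n by simp
  next
    case (Suc k)
    define u where "u = real k * (a + c)"
    have u: "0 \<le> u" using params by (simp add: u_def)
    have "1 - real (Suc k) * (a + c) \<le> 1 - a - u"
      using params by (simp add: u_def algebra_simps)
    also have "\<dots> \<le> (1 - a) * (1 - u)"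
      using mult_nonneg_nonneg[OF params(1) u] by (simp add: algebra_simps)
    finally have goal: "1 - real (Suc k) * (a + c) \<le> (1 - a) * (1 - u)" .
    show ?case
    proof (cases "x = n")
      case True
      have "(1 - a) * (1 - u) = \<eta> * (1 - u) + (1 - a - \<eta>) * (1 - u)" by (simp add: algebra_simps)
      also have "\<dots> \<le> K n (Suc n) * mat_pow S K k (Suc n) (2 * n)
          + K n (2 * n) * mat_pow S K k (2 * n) (2 * n)"
        using pow_from_upper_half[of "2 * n" k] pow_from_upper_half[of "Suc n" k] n params Suc.prems True
        by (auto simp: entries u_def intro!: mult_left_mono add_mono)
      also have "\<dots> \<le> mat_pow S K (Suc k) n (2 * n)"
        using n by (intro mat_pow_Suc_ge_two[OF finite_S stoch]) (auto simp: S_def)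
      finally show ?thesis using goal True by simp
    next
      case False
      then have x: "x < n" using Suc.prems by simp
      have "(1 - a) * (1 - u) \<le> K x (Suc x) * mat_pow S K k (Suc x) (2 * n)"
        using Suc.IH[of "Suc x"] Suc.prems x params
        by (auto simp: entries u_def intro!: mult_left_mono)
      also have "\<dots> \<le> mat_pow S K (Suc k) x (2 * n)"
        using x by (intro mat_pow_Suc_ge_one[OF finite_S stoch]) (auto simp: S_def)
      finally show ?thesis using goal by simp
    qed
  qed
qed

text \<open>All states reach \<open>2 n\<close> within \<open>n + 1\<close> steps unless they miss the shortcut; the states above \<open>n\<close>
are less than \<open>n\<close> steps away from \<open>2 n\<close> anyway.\<close>

lemma heat_fast:
  assumes "x \<le> 2 * n" "0 \<le> s"
  shows "(1 - \<eta> - real (n + 1) * (a + c)) * (1 - poisson_below (n + 1) s) \<le> heat_kernel S K s x (2 * n)"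
proof (rule heat_kernel_ge_of_late[OF finite_S stoch \<open>0 \<le> s\<close>])
  fix k assume k: "n + 1 \<le> k"
  have "1 - \<eta> - real (n + 1) * (a + c) \<le> mat_pow S K (n + 1) y (2 * n)" if "y \<in> S" for y
  proof (cases "n < y")
    case True
    then show ?thesis using pow_from_upper_half[of y "n + 1"] that params by (auto simp: S_def)
  next
    case False
    then show ?thesis using pow_fast[of y "n + 1"] by simp
  qed
  then show "1 - \<eta> - real (n + 1) * (a + c) \<le> mat_pow S K k x (2 * n)"
    by (rule mat_pow_lower_bound_persists[OF finite_S stoch _ k]) (use assms in \<open>auto simp: S_def\<close>)
qed (use assms in \<open>auto simp: S_def\<close>)

lemma heat_slow:
  assumes "x \<le> 2 * n" "0 \<le> s"
  shows "(1 - real (2 * n) * (a + c)) * (1 - poisson_below (2 * n) s) \<le> heat_kernel S K s x (2 * n)"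
proof (rule heat_kernel_ge_of_late[OF finite_S stoch \<open>0 \<le> s\<close>])
  fix k assume k: "2 * n \<le> k"
  have "1 - real (2 * n) * (a + c) \<le> mat_pow S K (2 * n) y (2 * n)" if "y \<in> S" for y
    using pow_slow[of y "2 * n"] that by (simp add: S_def)
  then show "1 - real (2 * n) * (a + c) \<le> mat_pow S K k x (2 * n)"
    by (rule mat_pow_lower_bound_persists[OF finite_S stoch _ k]) (use assms in \<open>auto simp: S_def\<close>)
qed (use assms in \<open>auto simp: S_def\<close>)

lemma stationary_top:
  assumes "stationary_distribution S K \<pi>"
  shows "1 - real (2 * n) * (a + c) \<le> \<pi> (2 * n)"
proof (rule stationary_lower_bound[OF finite_S assms])
  fix y assume "y \<in> S"
  then show "1 - real (2 * n) * (a + c) \<le> mat_pow S K (2 * n) y (2 * n)"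
    using pow_slow[of y "2 * n"] by (simp add: S_def)
qed (simp add: S_def)

lemma pow_too_early:
  assumes "x + k \<le> n"
  shows "mat_pow S K k x (2 * n) = 0"
  using assms
proof (induction k arbitrary: x)
  case 0
  then show ?case using n by (simp add: id_mat_def)
next
  case (Suc k)
  have "K x z * mat_pow S K k z (2 * n) = 0" if "z \<in> S" for z
  proof (cases "z \<le> Suc x")
    case True
    then show ?thesis using Suc by auto
  next
    case False
    then show ?thesis using Suc.prems by (auto simp: K_def shortcut_kernel_def)
  qed
  then show ?case unfolding mat_pow.simps by (rule sum.neutral[OF ballI])
qed

text \<open>The long route followed without a backward step.\<close>

lemma pow_straight:
  assumes "x + k < 2 * n"
  shows "(1 - a) ^ k * (if x \<le> n then \<eta> else 1) \<le> mat_pow S K k x (x + k)"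
  using assms
proof (induction k arbitrary: x)
  case 0
  then show ?case using params by (simp add: id_mat_def)
next
  case (Suc k)
  have IH: "(1 - a) ^ k * (if Suc x \<le> n then \<eta> else 1) \<le> mat_pow S K k (Suc x) (x + Suc k)"
    using Suc.IH[of "Suc x"] Suc.prems by simp
  have le1: "(1 - a) * \<eta> \<le> 1 * \<eta>" using params by (intro mult_right_mono) auto
  have "(1 - a) ^ Suc k * (if x \<le> n then \<eta> else 1)
      = (1 - a) ^ k * ((1 - a) * (if x \<le> n then \<eta> else 1))" by simp
  also have "\<dots> \<le> (1 - a) ^ k * (K x (Suc x) * (if Suc x \<le> n then \<eta> else 1))"
    using le1 Suc.prems params
    by (intro mult_left_mono) (cases "x = n"; cases "x < n"; auto simp: entries)+
  also have "\<dots> = K x (Suc x) * ((1 - a) ^ k * (if Suc x \<le> n then \<eta> else 1))" by simp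
  also have "\<dots> \<le> K x (Suc x) * mat_pow S K k (Suc x) (x + Suc k)"
    using stoch Suc.prems by (intro mult_left_mono IH) (auto simp: stochastic_def S_def)
  also have "\<dots> \<le> mat_pow S K (Suc k) x (x + Suc k)"
    using Suc.prems by (intro mat_pow_Suc_ge_one[OF finite_S stoch]) (auto simp: S_def)
  finally show ?case .
qed

lemma heat_too_early:
  assumes "0 \<le> s"
  shows "heat_kernel S K s 0 (2 * n) \<le> 1 - poisson_below (n + 1) s"
proof -
  have "heat_kernel S K s 0 (2 * n) \<le> 1 - (1 - 0) * poisson_below (n + 1) s"
  proof (rule heat_kernel_le_of_early[OF finite_S stoch assms])
    show "mat_pow S K k 0 (2 * n) \<le> 0" if "k < n + 1" for k
      using pow_too_early[of 0 k] that by simp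
  qed (auto simp: S_def)
  then show ?thesis by simp
qed

text \<open>After \<open>k < 2 n\<close> steps of the long route the chain is at \<open>k\<close>, not at \<open>2 n\<close>.\<close>

lemma heat_before_slow:
  assumes "0 \<le> s"
  shows "heat_kernel S K s 0 (2 * n) \<le> 1 - \<eta> * (1 - real (2 * n) * a) * poisson_below (2 * n) s"
proof -
  have "mat_pow S K k 0 (2 * n) \<le> 1 - \<eta> * (1 - real (2 * n) * a)" if k: "k < 2 * n" for k
  proof -
    have st: "stochastic S (mat_pow S K k)" by (rule stochastic_mat_pow[OF finite_S stoch])
    have "real k * a \<le> real (2 * n) * a" using k params by (intro mult_right_mono) auto
    then have "1 - real (2 * n) * a \<le> (1 - a) ^ k"
      using Bernoulli_inequality[of "- a" k] params by (simp add: algebra_simps)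
    then have "\<eta> * (1 - real (2 * n) * a) \<le> \<eta> * (1 - a) ^ k"
      using params by (intro mult_left_mono) auto
    also have "\<dots> \<le> mat_pow S K k 0 k" using pow_straight[of 0 k] k by (simp add: mult.commute)
    also have "mat_pow S K k 0 k + mat_pow S K k 0 (2 * n) = (\<Sum>y\<in>{k, 2 * n}. mat_pow S K k 0 y)"
      using k by simp
    also have "\<dots> \<le> (\<Sum>y\<in>S. mat_pow S K k 0 y)"
      using st k by (intro sum_mono2) (auto simp: stochastic_def S_def)
    also have "\<dots> = 1" using st by (simp add: stochastic_def S_def)
    finally show ?thesis by simp
  qed
  then have "heat_kernel S K s 0 (2 * n)
      \<le> 1 - (1 - (1 - \<eta> * (1 - real (2 * n) * a))) * poisson_below (2 * n) s"
    by (intro heat_kernel_le_of_early[OF finite_S stoch assms]) (auto simp: S_def)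
  then show ?thesis by simp
qed

end

section \<open>Products of shortcut chains\<close>

lemma one_minus_ge_exp:
  assumes "0 \<le> x" "x \<le> 1 / 2"
  shows "exp (- 2 * x) \<le> 1 - (x :: real)"
proof -
  have "1 \<le> (1 - x) * (1 + 2 * x)"
    using mult_nonneg_nonneg[of x "1 - 2 * x"] assms by (simp add: algebra_simps)
  also have "\<dots> \<le> (1 - x) * exp (2 * x)" using assms by (intro mult_left_mono) auto
  finally show ?thesis by (simp add: exp_minus field_simps)
qed

text \<open>The ratio of the geometric decay in both Chernoff bounds: of the lower tail for \<open>\<epsilon> > 0\<close>, and of the
upper tail for \<open>\<epsilon> < 0\<close>.\<close>

lemma chernoff_ratio_less_1:
  assumes "\<epsilon> \<noteq> (0 :: real)"
  shows "(1 + \<epsilon>) * exp (- \<epsilon>) < 1"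
proof -
  have "1 + \<epsilon> < exp \<epsilon>"
  proof (cases "0 \<le> 1 + \<epsilon> / 2")
    case True
    have "1 + \<epsilon> < (1 + \<epsilon> / 2)\<^sup>2" using assms
      by (simp add: power2_eq_square algebra_simps) (simp flip: power2_eq_square)
    also have "\<dots> \<le> (exp (\<epsilon> / 2))\<^sup>2" using True by (intro power_mono exp_ge_add_one_self) auto
    also have "\<dots> = exp \<epsilon>" by (simp flip: exp_double)
    finally show ?thesis .
  next
    case False
    then show ?thesis using exp_gt_zero[of \<epsilon>] by linarith
  qed
  then show ?thesis by (simp add: exp_minus field_simps)
qed

text \<open>The hypotheses of the main theorem about the family, with the constant of the bounds on \<open>a\<close> and \<open>b\<close>
fixed.\<close>

locale shortcut_family =
  fixes \<beta> C :: real
    and p a b c :: "nat \<Rightarrow> nat \<Rightarrow> real"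
    and \<pi> :: "nat \<Rightarrow> nat \<Rightarrow> nat \<Rightarrow> real"
    and q :: "nat \<Rightarrow> real"
    and X :: "nat \<Rightarrow> (nat \<Rightarrow> nat) set"
    and K :: "nat \<Rightarrow> (nat \<Rightarrow> nat) kernel"
    and \<mu> :: "nat \<Rightarrow> (nat \<Rightarrow> nat) \<Rightarrow> real"
  assumes \<beta>: "0 < \<beta>"
    and p_pos: "\<And>n i. 2 \<le> n \<Longrightarrow> i \<in> {1..n} \<Longrightarrow> 0 < p n i"
    and chain: "\<And>n i. 2 \<le> n \<Longrightarrow> i \<in> {1..n} \<Longrightarrow>
          irreducible_markov_chain {0..2 * n}
            (shortcut_kernel \<beta> n (a n i) (b n i) (c n i)) (\<pi> n i)"
    and reversible: "\<And>n i. 2 \<le> n \<Longrightarrow> i \<in> {1..n} \<Longrightarrow>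
          b n i * c n i * (1 - a n i) ^ (n - 1) * real n powr (- \<beta>)
            = (1 - a n i - b n i * real n powr (- \<beta>)) * a n i ^ n"
    and C: "1 < C"
    and sum_a: "\<And>n. 2 \<le> n \<Longrightarrow> (\<Sum>i=1..n. a n i) \<le> C * real n powr (- \<beta> - 1)"
    and b_bounds: "\<And>n i. 2 \<le> n \<Longrightarrow> i \<in> {1..n} \<Longrightarrow> inverse C \<le> b n i \<and> b n i \<le> C"
  defines "q \<equiv> \<lambda>n. \<Sum>i=1..n. p n i"
    and "X \<equiv> \<lambda>n. product_space {1..n} (\<lambda>i. {0..2 * n})"
    and "K \<equiv> \<lambda>n. product_kernel {1..n} (\<lambda>i. p n i / q n)
                 (\<lambda>i. shortcut_kernel \<beta> n (a n i) (b n i) (c n i))"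
    and "\<mu> \<equiv> \<lambda>n. product_distribution {1..n} (\<pi> n)"
begin

definition d :: "nat \<Rightarrow> real \<Rightarrow> real" where
  "d n t = tv_distance_c (X n) (K n) (\<mu> n) t"

text \<open>The expected number of steps of coordinate \<open>i\<close> by time \<open>t\<close>.\<close>

definition clock :: "nat \<Rightarrow> real \<Rightarrow> nat \<Rightarrow> real" where
  "clock n t i = t * (p n i / q n)"

text \<open>The probability that coordinate \<open>i\<close>, started at \<open>x\<close>, is at \<open>2 n\<close> at time \<open>t\<close>.\<close>

definition at_target :: "nat \<Rightarrow> real \<Rightarrow> nat \<Rightarrow> nat \<Rightarrow> real" where
  "at_target n t i x = heat_kernel {0..2 * n} (shortcut_kernel \<beta> n (a n i) (b n i) (c n i))
     (clock n t i) x (2 * n)"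

definition \<eta> :: "nat \<Rightarrow> nat \<Rightarrow> real" where
  "\<eta> n i = b n i * real n powr (- \<beta>)"

definition target :: "nat \<Rightarrow> nat \<Rightarrow> nat" where
  "target n = (\<lambda>i\<in>{1..n}. 2 * n)"

lemma q_pos: "2 \<le> n \<Longrightarrow> 0 < q n"
  unfolding q_def using p_pos by (intro sum_pos) auto

lemma clock_nonneg: "2 \<le> n \<Longrightarrow> i \<in> {1..n} \<Longrightarrow> 0 \<le> t \<Longrightarrow> 0 \<le> clock n t i"
  using p_pos[of n i] q_pos[of n] by (simp add: clock_def)

lemma X_eq: "X n = Pi\<^sub>E {1..n} (\<lambda>i. {0..2 * n})"
  by (simp add: X_def product_space_def)

lemma finite_X: "finite (X n)"
  unfolding X_eq by (intro finite_PiE) auto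

lemma target_in_X: "target n \<in> X n"
  by (auto simp: target_def X_eq)

lemma stochastic_component:
  "2 \<le> n \<Longrightarrow> i \<in> {1..n} \<Longrightarrow> stochastic {0..2 * n} (shortcut_kernel \<beta> n (a n i) (b n i) (c n i))"
  using chain by (simp add: irreducible_markov_chain_def)

lemma stationary_component:
  "2 \<le> n \<Longrightarrow> i \<in> {1..n} \<Longrightarrow>
    stationary_distribution {0..2 * n} (shortcut_kernel \<beta> n (a n i) (b n i) (c n i)) (\<pi> n i)"
  using chain by (simp add: irreducible_markov_chain_def)

lemma weights_sum: "2 \<le> n \<Longrightarrow> (\<Sum>i\<in>{1..n}. p n i / q n) = 1"
  using q_pos[of n] by (simp add: q_def flip: sum_divide_distrib)

lemma heat_kernel_target:
  assumes "2 \<le> n" "x \<in> X n"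
  shows "heat_kernel (X n) (K n) t x (target n) = (\<Prod>i=1..n. at_target n t i (x i))"
proof -
  have "heat_kernel (X n) (K n) t x (target n)
      = (\<Prod>i=1..n. heat_kernel {0..2 * n} (shortcut_kernel \<beta> n (a n i) (b n i) (c n i))
           (t * (p n i / q n)) (x i) (target n i))"
    unfolding X_eq K_def
    by (rule heat_kernel_product[OF _ _ weights_sum[OF assms(1)]])
       (use assms(2) target_in_X[of n] in \<open>simp_all add: X_eq\<close>)
  also have "\<dots> = (\<Prod>i=1..n. at_target n t i (x i))"
    by (intro prod.cong) (auto simp: at_target_def clock_def target_def)
  finally show ?thesis .
qed

lemma stochastic_heat:
  assumes "2 \<le> n" "0 \<le> t"
  shows "stochastic (X n) (heat_kernel (X n) (K n) t)"
  unfolding X_eq K_def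
proof (rule stochastic_heat_kernel_product[OF _ _ weights_sum[OF assms(1)]])
  fix i assume i: "i \<in> {1..n}"
  then show "0 \<le> p n i / q n" using assms p_pos[of n i] q_pos[of n] by simp
  show "stochastic {0..2 * n} (shortcut_kernel \<beta> n (a n i) (b n i) (c n i))"
    using assms(1) i by (rule stochastic_component)
qed (use assms(2) in simp_all)

lemma \<mu>_prob:
  assumes "2 \<le> n"
  shows "x \<in> X n \<Longrightarrow> 0 \<le> \<mu> n x" "(\<Sum>x\<in>X n. \<mu> n x) = 1"
proof -
  note st = stationary_component[OF assms, unfolded stationary_distribution_def]
  show "0 \<le> \<mu> n x" if "x \<in> X n"
    unfolding \<mu>_def product_distribution_def
  proof (rule prod_nonneg)
    fix i assume "i \<in> {1..n}"
    moreover have "x i \<in> {0..2 * n}" using \<open>i \<in> {1..n}\<close> that unfolding X_eq by (rule PiE_mem[rotated])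
    ultimately show "0 \<le> \<pi> n i (x i)" using st[of i] by blast
  qed
  have "(\<Sum>x\<in>X n. \<mu> n x) = (\<Prod>i\<in>{1..n}. \<Sum>u\<in>{0..2 * n}. \<pi> n i u)"
    unfolding X_eq \<mu>_def product_distribution_def by (intro prod_sum_PiE[symmetric]) auto
  also have "\<dots> = (\<Prod>i\<in>{1..n}. 1)" using st by (intro prod.cong) auto
  finally show "(\<Sum>x\<in>X n. \<mu> n x) = 1" by simp
qed

lemma
  assumes "2 \<le> n" "0 \<le> t"
  shows d_nonneg: "0 \<le> d n t" and d_le_1: "d n t \<le> 1"
    and d_ge: "\<mu> n (target n) - (\<Prod>i=1..n. at_target n t i 0) \<le> d n t"
    and d_le: "(\<And>x. x \<in> X n \<Longrightarrow> v \<le> (\<Prod>i=1..n. at_target n t i (x i)))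
                 \<Longrightarrow> d n t \<le> (1 - \<mu> n (target n)) + (1 - v)"
proof -
  note * = finite_X stochastic_heat[OF assms] \<mu>_prob[OF assms(1)] target_in_X
  show "0 \<le> d n t" "d n t \<le> 1"
    unfolding d_def using tv_distance_c_nonneg[OF *] tv_distance_c_le_1[OF *] by auto
  have "(\<lambda>i\<in>{1..n}. 0) \<in> X n" by (auto simp: X_eq)
  moreover have "(\<Prod>i=1..n. at_target n t i ((\<lambda>i\<in>{1..n}. 0) i)) = (\<Prod>i=1..n. at_target n t i 0)"
    by (intro prod.cong) auto
  ultimately show "\<mu> n (target n) - (\<Prod>i=1..n. at_target n t i 0) \<le> d n t"
    unfolding d_def using tv_distance_c_ge_point[OF *, of "\<lambda>i\<in>{1..n}. 0"] assms
    by (simp add: heat_kernel_target)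
  show "d n t \<le> (1 - \<mu> n (target n)) + (1 - v)"
    if "\<And>x. x \<in> X n \<Longrightarrow> v \<le> (\<Prod>i=1..n. at_target n t i (x i))"
    unfolding d_def using tv_distance_c_le_point[OF *, of v] that assms by (simp add: heat_kernel_target)
qed

lemma component:
  assumes "2 \<le> n" "i \<in> {1..n}"
  shows "0 \<le> a n i" "0 \<le> c n i" "0 \<le> \<eta> n i" "a n i + \<eta> n i \<le> 1"
    and "1 - real (2 * n) * (a n i + c n i) \<le> \<pi> n i (2 * n)"
    and "0 \<le> t \<Longrightarrow> x \<le> 2 * n \<Longrightarrow>
          (1 - \<eta> n i - real (n + 1) * (a n i + c n i)) * (1 - poisson_below (n + 1) (clock n t i)) \<le> at_target n t i x"
    and "0 \<le> t \<Longrightarrow> x \<le> 2 * n \<Longrightarrow>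
          (1 - real (2 * n) * (a n i + c n i)) * (1 - poisson_below (2 * n) (clock n t i)) \<le> at_target n t i x"
    and "0 \<le> t \<Longrightarrow> at_target n t i 0 \<le> 1 - poisson_below (n + 1) (clock n t i)"
    and "0 \<le> t \<Longrightarrow>
          at_target n t i 0 \<le> 1 - \<eta> n i * (1 - real (2 * n) * a n i) * poisson_below (2 * n) (clock n t i)"
    and "0 \<le> t \<Longrightarrow> x \<le> 2 * n \<Longrightarrow> 0 \<le> at_target n t i x"
    and "0 \<le> t \<Longrightarrow> x \<le> 2 * n \<Longrightarrow> at_target n t i x \<le> 1"
proof -
  interpret sc: shortcut_chain \<beta> "a n i" "b n i" "c n i" n "b n i * real n powr (- \<beta>)" "{0..2 * n}"
    "shortcut_kernel \<beta> n (a n i) (b n i) (c n i)"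
    by unfold_locales (rule assms(1), rule stochastic_component[OF assms])
  show "0 \<le> a n i" "0 \<le> c n i" "0 \<le> \<eta> n i" "a n i + \<eta> n i \<le> 1"
    using sc.params by (simp_all add: \<eta>_def)
  show "1 - real (2 * n) * (a n i + c n i) \<le> \<pi> n i (2 * n)"
    using sc.stationary_top[OF stationary_component[OF assms]] .
  assume t: "0 \<le> t"
  note s = clock_nonneg[OF assms t]
  show "(1 - \<eta> n i - real (n + 1) * (a n i + c n i)) * (1 - poisson_below (n + 1) (clock n t i)) \<le> at_target n t i x"
    if "x \<le> 2 * n" unfolding at_target_def \<eta>_def by (rule sc.heat_fast[OF that s])
  show "(1 - real (2 * n) * (a n i + c n i)) * (1 - poisson_below (2 * n) (clock n t i)) \<le> at_target n t i x"
    if "x \<le> 2 * n" unfolding at_target_def by (rule sc.heat_slow[OF that s])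
  show "at_target n t i 0 \<le> 1 - poisson_below (n + 1) (clock n t i)"
    unfolding at_target_def by (rule sc.heat_too_early[OF s])
  show "at_target n t i 0 \<le> 1 - \<eta> n i * (1 - real (2 * n) * a n i) * poisson_below (2 * n) (clock n t i)"
    unfolding at_target_def \<eta>_def by (rule sc.heat_before_slow[OF s])
  have st: "stochastic {0..2 * n} (heat_kernel {0..2 * n} (shortcut_kernel \<beta> n (a n i) (b n i) (c n i)) (clock n t i))"
    by (rule stochastic_heat_kernel[OF sc.finite_S sc.stoch s])
  show "0 \<le> at_target n t i x" "at_target n t i x \<le> 1" if "x \<le> 2 * n"
    unfolding at_target_def using that by (auto intro: stochastic_nonneg[OF st] stochastic_le_1[OF _ st])
qed

text \<open>Up to a constant factor, this bounds the probability that some coordinate deviates from its forward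
path within \<open>O(n)\<close> steps, and also the stationary mass outside the target state.\<close>

definition leak :: "nat \<Rightarrow> real" where
  "leak n = real n * (\<Sum>i=1..n. a n i + c n i)"

lemma \<eta>_le: "2 \<le> n \<Longrightarrow> i \<in> {1..n} \<Longrightarrow> \<eta> n i \<le> C * real n powr (- \<beta>)"
  and \<eta>_ge: "2 \<le> n \<Longrightarrow> i \<in> {1..n} \<Longrightarrow> real n powr (- \<beta>) / C \<le> \<eta> n i"
  using b_bounds[of n i] by (auto simp: \<eta>_def divide_inverse mult.commute intro!: mult_right_mono)

lemma powr_tendsto_0: "(\<lambda>n. A * real n powr (- \<beta>)) \<longlonglongrightarrow> 0"
  using \<beta> by real_asymp

lemma a_le:
  assumes "2 \<le> n" "i \<in> {1..n}"
  shows "real n * a n i \<le> C * real n powr (- \<beta>)"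
proof -
  have "a n i \<le> (\<Sum>i=1..n. a n i)"
    using assms by (intro member_le_sum) (auto simp: component(1))
  also have "\<dots> \<le> C * real n powr (- \<beta> - 1)" by (rule sum_a[OF assms(1)])
  also have "\<dots> = C * real n powr (- \<beta>) / real n"
    using assms by (simp add: powr_diff)
  finally show ?thesis using assms by (simp add: field_simps)
qed

text \<open>Reversibility makes \<open>c\<close> about \<open>n powr \<beta> * a ^ n / b\<close>, which is much smaller than \<open>a\<close> because
\<open>a = O(n powr (- \<beta> - 1))\<close>; as \<open>n \<ge> 2\<close>, the bound \<open>a ^ n \<le> a\<^sup>2\<close> suffices.\<close>

lemma c_le_a: "eventually (\<lambda>n. \<forall>i\<in>{1..n}. c n i \<le> a n i) sequentially"
proof -
  have "eventually (\<lambda>n. C * real n powr (- \<beta>) < 1 / 2) sequentially"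
    by (rule order_tendstoD(2)[OF powr_tendsto_0]) simp
  moreover have "eventually (\<lambda>n. 2 * C * C \<le> real n) sequentially"
    using filterlim_real_sequentially by (simp add: filterlim_at_top)
  moreover have "eventually (\<lambda>n. 2 \<le> n) sequentially" by (rule eventually_ge_at_top)
  ultimately show ?thesis
  proof eventually_elim
    case (elim n)
    show ?case
    proof
      fix i assume i: "i \<in> {1..n}"
      define A where "A = a n i"
      define B where "B = real n powr (- \<beta>)"
      have A: "0 \<le> A" "real n * A \<le> C * B" using elim i component(1) a_le by (auto simp: A_def B_def)
      have B: "0 < B" using elim by (simp add: B_def)
      have half: "real n * A \<le> 1 / 2" using A elim by (simp add: B_def)
      moreover have "1 * A \<le> real n * A" using elim A by (intro mult_right_mono) auto
      ultimately have A1: "A \<le> 1 / 2" by simp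
      have "real (n - 1) * A \<le> real n * A" using A by (intro mult_right_mono) auto
      then have pow: "1 / 2 \<le> (1 - A) ^ (n - 1)"
        using Bernoulli_inequality[of "- A" "n - 1"] A A1 half by simp
      have "inverse C * c n i * (1 / 2) * B \<le> b n i * c n i * (1 - A) ^ (n - 1) * B"
        using b_bounds[of n i] component(1-4)[of n i] elim i B pow C
        by (intro mult_mono) (auto intro!: mult_nonneg_nonneg intro: order.trans[OF _ conjunct1[OF b_bounds]])
      also have "\<dots> = (1 - A - \<eta> n i) * A ^ n"
        using reversible[of n i] elim i by (simp add: A_def B_def \<eta>_def)
      also have "\<dots> \<le> 1 * A ^ n"
        using component(1-4)[of n i] elim i A by (intro mult_right_mono) (auto simp: A_def)
      also have "\<dots> \<le> A ^ 2" using A A1 elim by (simp add: power_decreasing)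
      finally have "inverse C * c n i * (1 / 2) * B \<le> A ^ 2" .
      then have "c n i * B \<le> A * (2 * C * A)"
        using C by (simp add: field_simps power2_eq_square)
      also have "\<dots> \<le> A * B"
      proof (rule mult_left_mono)
        have "2 * C * A * real n \<le> 2 * C * (C * B)" using A C by (simp add: mult.commute)
        also have "\<dots> = 2 * C * C * B" by simp
        also have "\<dots> \<le> real n * B" using elim B by (intro mult_right_mono) auto
        finally show "2 * C * A \<le> B" using elim by simp
      qed (rule A)
      finally show "c n i \<le> a n i" using B by (simp add: A_def)
    qed
  qed
qed

lemma leak_tendsto_0: "leak \<longlonglongrightarrow> 0"
proof (rule tendsto_sandwich[OF _ _ tendsto_const powr_tendsto_0[of "2 * C"]])
  show "eventually (\<lambda>n. 0 \<le> leak n) sequentially"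
    using eventually_ge_at_top[of 2]
    by eventually_elim
      (unfold leak_def, intro mult_nonneg_nonneg sum_nonneg add_nonneg_nonneg component(1,2), auto)
  show "eventually (\<lambda>n. leak n \<le> 2 * C * real n powr (- \<beta>)) sequentially"
    using eventually_ge_at_top[of 2] c_le_a
  proof eventually_elim
    case (elim n)
    have "(\<Sum>i=1..n. a n i + c n i) \<le> (\<Sum>i=1..n. 2 * a n i)"
    proof (rule sum_mono)
      fix i assume "i \<in> {1..n}"
      then have "c n i \<le> a n i" using elim by blast
      then show "a n i + c n i \<le> 2 * a n i" by simp
    qed
    also have "\<dots> \<le> 2 * (C * real n powr (- \<beta> - 1))"
      using sum_a[of n] elim by (simp flip: sum_distrib_left)
    also have "\<dots> = 2 * C * real n powr (- \<beta>) / real n" using elim by (simp add: powr_diff)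
    finally show ?case using elim by (simp add: leak_def field_simps)
  qed
qed

lemma \<mu>_target:
  assumes "2 \<le> n"
  shows "1 - 2 * leak n \<le> \<mu> n (target n)"
proof -
  have "1 - (\<Sum>i=1..n. 1 - \<pi> n i (2 * n)) \<le> (\<Prod>i=1..n. 1 - (1 - \<pi> n i (2 * n)))"
  proof (rule Weierstrass_prod_ineq)
    fix i assume i: "i \<in> {1..n}"
    have nn: "\<And>x. x \<in> {0..2 * n} \<Longrightarrow> 0 \<le> \<pi> n i x"
      using stationary_component[OF assms i] by (simp add: stationary_distribution_def)
    then have "0 \<le> \<pi> n i (2 * n)" "\<pi> n i (2 * n) \<le> (\<Sum>x\<in>{0..2 * n}. \<pi> n i x)"
      by (auto intro: member_le_sum)
    moreover have "(\<Sum>x\<in>{0..2 * n}. \<pi> n i x) = 1"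
      using stationary_component[OF assms i] by (simp add: stationary_distribution_def)
    ultimately show "1 - \<pi> n i (2 * n) \<in> {0..1}" by simp
  qed
  also have "\<dots> = \<mu> n (target n)" by (simp add: \<mu>_def product_distribution_def target_def)
  finally have "1 - (\<Sum>i=1..n. 1 - \<pi> n i (2 * n)) \<le> \<mu> n (target n)" .
  moreover have "(\<Sum>i=1..n. 1 - \<pi> n i (2 * n)) \<le> (\<Sum>i=1..n. real (2 * n) * (a n i + c n i))"
    using component(5)[OF assms] by (intro sum_mono) (auto simp: algebra_simps)
  ultimately show ?thesis by (simp add: leak_def flip: sum_distrib_left)
qed

lemma component_le_leak:
  assumes "2 \<le> n" "i \<in> {1..n}"
  shows "real n * (a n i + c n i) \<le> leak n"
  unfolding leak_def using assms
  by (intro mult_left_mono member_le_sum[of i "{1..n}" "\<lambda>i. a n i + c n i"]) (auto simp: component(1,2))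

lemma n_power_tendsto_0: "\<bar>r\<bar> < 1 \<Longrightarrow> (\<lambda>n. real n * r ^ n) \<longlonglongrightarrow> (0 :: real)"
  using powser_times_n_limit_0[of r] by simp

text \<open>The coordinates in \<open>F\<close> have had time for the shortcut only, the others also for the long route.
Each coordinate in \<open>F\<close> arrives with probability at least about \<open>1 - C * n powr - \<beta>\<close>, each other one
with probability close to \<open>1\<close>, and by independence these probabilities multiply.\<close>

lemma d_upper:
  assumes "0 < \<epsilon>" "0 < \<delta>"
  shows "eventually (\<lambda>n. \<forall>t\<ge>0. \<forall>F\<subseteq>{1..n}.
           (\<forall>i\<in>F. (1 + \<epsilon>) * real n \<le> clock n t i) \<longrightarrow>
           (\<forall>i\<in>{1..n} - F. (1 + \<epsilon>) * (2 * real n) \<le> clock n t i) \<longrightarrow>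
           d n t \<le> 1 - exp (- 2 * C * real (card F) * real n powr (- \<beta>)) + \<delta>) sequentially"
proof -
  \<comment> \<open>Half of \<open>\<epsilon>\<close> absorbs the extra step in \<open>n + 1\<close>.\<close>
  define e where "e = \<epsilon> / 2"
  define r where "r = (1 + e) * exp (- e)"
  have e: "0 < e" using assms by (simp add: e_def)
  have r: "0 < r" "r < 1" using e chernoff_ratio_less_1[of e] by (auto simp: r_def add_pos_pos)
  have r_lim: "(\<lambda>n. r ^ n) \<longlonglongrightarrow> 0" using r by (intro LIMSEQ_realpow_zero) auto
  have "(\<lambda>n. 6 * leak n + real n * r ^ n) \<longlonglongrightarrow> 6 * 0 + 0"
    using r by (intro tendsto_intros leak_tendsto_0 n_power_tendsto_0) auto
  then have "eventually (\<lambda>n. 6 * leak n + real n * r ^ n < \<delta>) sequentially"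
    using assms by (auto intro: order_tendstoD)
  moreover have "eventually (\<lambda>n. C * real n powr (- \<beta>) < 1 / 2) sequentially"
    by (rule order_tendstoD(2)[OF powr_tendsto_0]) simp
  moreover have "eventually (\<lambda>n. r ^ n < 1 / 4) sequentially"
    by (rule order_tendstoD(2)[OF r_lim]) simp
  moreover have "eventually (\<lambda>n. leak n < 1 / 8) sequentially"
    by (rule order_tendstoD(2)[OF leak_tendsto_0]) simp
  moreover have "eventually (\<lambda>n. (1 + e) * (real n + 1) \<le> (1 + \<epsilon>) * real n) sequentially"
    unfolding e_def using assms by real_asymp
  moreover have "eventually (\<lambda>n. 2 \<le> n) sequentially" by (rule eventually_ge_at_top)
  ultimately show ?thesis
  proof eventually_elim
    case (elim n)
    define y where "y = exp (- 2 * (C * real n powr (- \<beta>)))"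
    \<comment> \<open>The part of the failure probability of coordinate \<open>i\<close> that does not come from missing the shortcut.\<close>
    define v where "v i = 4 * (real n * (a n i + c n i)) + r ^ n" for i
    show ?case
    proof (intro allI impI)
      fix t :: real and F assume t: "0 \<le> t" and F: "F \<subseteq> {1..n}"
        and fast: "\<forall>i\<in>F. (1 + \<epsilon>) * real n \<le> clock n t i"
        and slow: "\<forall>i\<in>{1..n} - F. (1 + \<epsilon>) * (2 * real n) \<le> clock n t i"
      have v01: "0 \<le> v i" "v i \<le> 1" if "i \<in> {1..n}" for i
        using component_le_leak[of n i] component(1-4)[of n i] that elim r by (auto simp: v_def)
      have pn: "0 \<le> poisson_below m (clock n t i)" if "i \<in> {1..n}" for i m
        using elim that t by (intro poisson_below_nonneg clock_nonneg)
      have low: "(if i \<in> F then y else 1) * (1 - v i) \<le> at_target n t i x"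
        if i: "i \<in> {1..n}" and x: "x \<le> 2 * n" for i x
      proof (cases "i \<in> F")
        case True
        define u where "u = real (n + 1) * (a n i + c n i)"
        define P where "P = poisson_below (n + 1) (clock n t i)"
        have "(1 + e) * real (n + 1) \<le> (1 + \<epsilon>) * real n" using elim by (simp add: algebra_simps)
        also have "\<dots> \<le> clock n t i" using fast True by blast
        finally have "P \<le> r ^ (n + 1)"
          unfolding P_def r_def using e by (intro poisson_below_upper) auto
        also have "\<dots> \<le> r ^ n" using r by (intro power_decreasing) auto
        finally have P: "0 \<le> P" "P \<le> r ^ n" using pn[OF i] by (auto simp: P_def)
        have "u \<le> real (2 * n) * (a n i + c n i)"
          unfolding u_def using component(1-4)[of n i] i elim by (intro mult_right_mono) auto
        also have "\<dots> = 2 * (real n * (a n i + c n i))" by simp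
        finally have "u \<le> 2 * (real n * (a n i + c n i))" .
        moreover have "0 \<le> u" using component(1-4)[of n i] i elim by (simp add: u_def)
        ultimately have u: "0 \<le> u" "2 * u + P \<le> v i" using P by (auto simp: v_def)
        have \<eta>2: "\<eta> n i \<le> 1 / 2" "0 \<le> \<eta> n i" using \<eta>_le[of n i] component(1-4)[of n i] i elim by auto
        have "y \<le> exp (- 2 * \<eta> n i)" using \<eta>_le[of n i] i elim by (simp add: y_def)
        also have "\<dots> \<le> 1 - \<eta> n i" using \<eta>2 by (intro one_minus_ge_exp) auto
        finally have "y * (1 - v i) \<le> (1 - \<eta> n i) * (1 - v i)"
          using v01 i by (intro mult_right_mono) auto
        also have "\<dots> \<le> (1 - \<eta> n i) * ((1 - 2 * u) * (1 - P))"
          using mult_nonneg_nonneg[OF u(1) P(1)] u \<eta>2 by (intro mult_left_mono) (auto simp: algebra_simps)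
        also have "\<dots> = ((1 - \<eta> n i) * (1 - 2 * u)) * (1 - P)" by simp
        also have "\<dots> \<le> (1 - \<eta> n i - u) * (1 - P)"
          using mult_nonneg_nonneg[of u "1 - 2 * \<eta> n i"] u \<eta>2 P elim
          by (intro mult_right_mono) (auto simp: algebra_simps)
        also have "\<dots> \<le> at_target n t i x" using component(6)[of n i t x] t x i elim by (simp add: u_def P_def)
        finally show ?thesis using True by simp
      next
        case False
        define u where "u = real (2 * n) * (a n i + c n i)"
        define P where "P = poisson_below (2 * n) (clock n t i)"
        have "(1 + e) * (2 * real n) \<le> (1 + \<epsilon>) * (2 * real n)"
          using assms by (intro mult_right_mono) (auto simp: e_def)
        also have "\<dots> \<le> clock n t i" using slow False i by blast
        finally have "P \<le> r ^ (2 * n)"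
          unfolding P_def r_def using e by (intro poisson_below_upper) auto
        also have "\<dots> \<le> r ^ n" using r by (intro power_decreasing) auto
        finally have P: "0 \<le> P" "P \<le> r ^ n" using pn[OF i] by (auto simp: P_def)
        have "0 \<le> real n * (a n i + c n i)" using component(1-4)[of n i] i elim by simp
        moreover have "u = 2 * (real n * (a n i + c n i))" by (simp add: u_def)
        ultimately have u: "0 \<le> u" "u + P \<le> v i" using P by (auto simp: v_def)
        then have "1 - v i \<le> (1 - u) * (1 - P)"
          using mult_nonneg_nonneg[OF u(1) P(1)] by (simp add: algebra_simps)
        also have "\<dots> \<le> at_target n t i x" using component(7)[of n i t x] t x i elim by (simp add: u_def P_def)
        finally show ?thesis using False by simp
      qed
      have y: "0 < y" "y \<le> 1" using C by (auto simp: y_def)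
      have yF: "(\<Prod>i=1..n. if i \<in> F then y else 1) = y ^ card F"
        using F by (simp add: prod.If_cases Int_absorb1)
      have "d n t \<le> (1 - \<mu> n (target n)) + (1 - (y ^ card F - (\<Sum>i=1..n. v i)))"
      proof (rule d_le)
        fix x assume x: "x \<in> X n"
        have "y ^ card F - (\<Sum>i=1..n. v i) \<le> y ^ card F - y ^ card F * (\<Sum>i=1..n. v i)"
        proof -
          have "0 \<le> (\<Sum>i=1..n. v i)" by (intro sum_nonneg v01(1))
          moreover have "y ^ card F \<le> 1" using y by (intro power_le_one) auto
          ultimately have "y ^ card F * (\<Sum>i=1..n. v i) \<le> 1 * (\<Sum>i=1..n. v i)"
            by (intro mult_right_mono)
          then show ?thesis by simp
        qed
        also have "\<dots> = y ^ card F * (1 - (\<Sum>i=1..n. v i))" by (simp add: algebra_simps)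
        also have "\<dots> \<le> y ^ card F * (\<Prod>i=1..n. 1 - v i)"
          using y v01 by (intro mult_left_mono Weierstrass_prod_ineq) auto
        also have "\<dots> = (\<Prod>i=1..n. (if i \<in> F then y else 1) * (1 - v i))"
          by (simp only: prod.distrib yF)
        also have "\<dots> \<le> (\<Prod>i=1..n. at_target n t i (x i))"
        proof (rule prod_mono)
          fix i assume i: "i \<in> {1..n}"
          then have "x i \<le> 2 * n" using x by (auto simp: X_eq PiE_iff)
          then show "0 \<le> (if i \<in> F then y else 1) * (1 - v i) \<and>
              (if i \<in> F then y else 1) * (1 - v i) \<le> at_target n t i (x i)"
            using low[OF i] v01[OF i] y by auto
        qed
        finally show "y ^ card F - (\<Sum>i=1..n. v i) \<le> (\<Prod>i=1..n. at_target n t i (x i))" .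
      qed (use elim t in auto)
      also have "(\<Sum>i=1..n. v i) = 4 * leak n + real n * r ^ n"
        unfolding v_def leak_def by (simp add: sum.distrib flip: sum_distrib_left)
      also have "y ^ card F = exp (- 2 * C * real (card F) * real n powr (- \<beta>))"
        by (simp add: y_def mult_ac flip: exp_of_nat_mult)
      finally show "d n t \<le> 1 - exp (- 2 * C * real (card F) * real n powr (- \<beta>)) + \<delta>"
        using \<mu>_target[of n] elim by simp
    qed
  qed
qed

text \<open>A single coordinate that has not had time to make \<open>n + 1\<close> steps keeps the chain from the target.\<close>

lemma d_lower_fast:
  assumes "0 < \<epsilon>" "\<epsilon> < 1" "0 < \<delta>"
  shows "eventually (\<lambda>n. \<forall>t\<ge>0. \<forall>i\<in>{1..n}. clock n t i \<le> (1 - \<epsilon>) * real n \<longrightarrow> 1 - \<delta> \<le> d n t) sequentially"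
proof -
  define r where "r = (1 - \<epsilon>) * exp \<epsilon>"
  have r: "0 < r" "r < 1" using assms chernoff_ratio_less_1[of "- \<epsilon>"] by (auto simp: r_def)
  have "(\<lambda>n. 2 * leak n + r ^ n) \<longlonglongrightarrow> 2 * 0 + 0"
    using r by (intro tendsto_intros leak_tendsto_0 LIMSEQ_realpow_zero) auto
  then have "eventually (\<lambda>n. 2 * leak n + r ^ n < \<delta>) sequentially"
    using assms by (auto intro: order_tendstoD)
  then show ?thesis using eventually_ge_at_top[of 2]
  proof eventually_elim
    case (elim n)
    show ?case
    proof (intro allI impI ballI)
      fix t :: real and i assume t: "0 \<le> t" and i: "i \<in> {1..n}" and s: "clock n t i \<le> (1 - \<epsilon>) * real n"
      have "(1 - \<epsilon>) * real n \<le> (1 - \<epsilon>) * real (n + 1)" using assms by (intro mult_left_mono) auto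
      with s have "clock n t i \<le> (1 - \<epsilon>) * real (n + 1)" by (rule order.trans)
      then have "1 - r ^ (n + 1) \<le> poisson_below (n + 1) (clock n t i)"
        unfolding r_def using assms by (intro poisson_below_lower clock_nonneg elim t i) auto
      moreover have "r ^ (n + 1) \<le> r ^ n" using r by (intro power_decreasing) auto
      ultimately have hi: "at_target n t i 0 \<le> r ^ n" using component(8)[of n i t] elim t i by simp
      have "(\<Prod>j=1..n. at_target n t j 0) = at_target n t i 0 * (\<Prod>j\<in>{1..n} - {i}. at_target n t j 0)"
        using i by (simp add: prod.remove)
      also have "\<dots> \<le> at_target n t i 0 * 1"
        using elim t i by (intro mult_left_mono prod_le_1) (auto simp: component(10,11))
      finally show "1 - \<delta> \<le> d n t" using hi d_ge[of n t] \<mu>_target[of n] elim t by simp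
    qed
  qed
qed

text \<open>By independence, the probability that no coordinate in \<open>J\<close> misses the shortcut is exponentially small
in \<open>card J * n powr - \<beta>\<close>; a coordinate in \<open>J\<close> that misses it is still under way.\<close>

lemma d_lower_slow:
  assumes "0 < \<epsilon>" "\<epsilon> < 1" "0 < \<delta>"
  shows "eventually (\<lambda>n. \<forall>t\<ge>0. \<forall>J\<subseteq>{1..n}. (\<forall>i\<in>J. clock n t i \<le> (1 - \<epsilon>) * (2 * real n)) \<longrightarrow>
           1 - exp (- (real (card J) * real n powr (- \<beta>) / (4 * C))) - \<delta> \<le> d n t) sequentially"
proof -
  define r where "r = (1 - \<epsilon>) * exp \<epsilon>"
  have r: "0 < r" "r < 1" using assms chernoff_ratio_less_1[of "- \<epsilon>"] by (auto simp: r_def)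
  have r_lim: "(\<lambda>n. r ^ n) \<longlonglongrightarrow> 0" using r by (intro LIMSEQ_realpow_zero) auto
  have "(\<lambda>n. 2 * leak n) \<longlonglongrightarrow> 0" using tendsto_mult[OF tendsto_const leak_tendsto_0, of 2] by simp
  then have "eventually (\<lambda>n. 2 * leak n < \<delta>) sequentially"
    using assms by (intro order_tendstoD(2)[of _ 0]) auto
  moreover have "eventually (\<lambda>n. leak n < 1 / 4) sequentially"
    by (rule order_tendstoD(2)[OF leak_tendsto_0]) simp
  moreover have "eventually (\<lambda>n. r ^ n < 1 / 2) sequentially"
    by (rule order_tendstoD(2)[OF r_lim]) simp
  moreover have "eventually (\<lambda>n. 2 \<le> n) sequentially" by (rule eventually_ge_at_top)
  ultimately show ?thesis
  proof eventually_elim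
    case (elim n)
    define y where "y = exp (- (real n powr (- \<beta>) / (4 * C)))"
    show ?case
    proof (intro allI impI)
      fix t :: real and J assume t: "0 \<le> t" and J: "J \<subseteq> {1..n}"
        and s: "\<forall>i\<in>J. clock n t i \<le> (1 - \<epsilon>) * (2 * real n)"
      have hy: "at_target n t i 0 \<le> (if i \<in> J then y else 1)" if i: "i \<in> {1..n}" for i
      proof (cases "i \<in> J")
        case True
        have "1 - r ^ (2 * n) \<le> poisson_below (2 * n) (clock n t i)"
          unfolding r_def using assms s True by (intro poisson_below_lower clock_nonneg elim t i) auto
        moreover have "r ^ (2 * n) \<le> r ^ n" using r by (intro power_decreasing) auto
        ultimately have P: "1 / 2 \<le> poisson_below (2 * n) (clock n t i)" using elim by simp
        have "real n * a n i \<le> real n * (a n i + c n i)"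
          using component(1-4)[of n i] i elim by (intro mult_left_mono) auto
        also have "\<dots> \<le> leak n" using component_le_leak[of n i] i elim by simp
        finally have "real n * a n i \<le> leak n" .
        then have "real (2 * n) * a n i \<le> 1 / 2" using elim by simp
        then have "\<eta> n i * (1 / 2) * (1 / 2)
            \<le> \<eta> n i * (1 - real (2 * n) * a n i) * poisson_below (2 * n) (clock n t i)"
          using component(1-4)[of n i] i elim P by (intro mult_mono mult_nonneg_nonneg) auto
        then have "at_target n t i 0 \<le> 1 - \<eta> n i / 4" using component(9)[of n i t] i elim t by simp
        also have "\<dots> \<le> 1 - real n powr (- \<beta>) / (4 * C)" using \<eta>_ge[of n i] i elim by simp
        also have "\<dots> \<le> y"
          unfolding y_def using exp_ge_add_one_self[of "- (real n powr (- \<beta>) / (4 * C))"] by simp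
        finally show ?thesis using True by simp
      next
        case False
        then show ?thesis using component(11)[of n i t 0] i elim t by simp
      qed
      have "(\<Prod>i=1..n. at_target n t i 0) \<le> (\<Prod>i=1..n. if i \<in> J then y else 1)"
        using hy component(10)[of n _ t 0] elim t by (intro prod_mono) auto
      also have "\<dots> = y ^ card J" using J by (simp add: prod.If_cases Int_absorb1)
      also have "\<dots> = exp (- (real (card J) * real n powr (- \<beta>) / (4 * C)))"
        by (simp add: y_def flip: exp_of_nat_mult)
      finally show "1 - exp (- (real (card J) * real n powr (- \<beta>) / (4 * C))) - \<delta> \<le> d n t"
        using d_ge[of n t] \<mu>_target[of n] elim t by simp
    qed
  qed
qed

end

section \<open>Cutoff times\<close>

lemma
  fixes r :: real
  shows card_below_le: "0 \<le> r \<Longrightarrow> real (card {i\<in>{1..n}. real i \<le> r}) \<le> r"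
    and card_below_ge: "r \<le> real n \<Longrightarrow> r - 1 \<le> real (card {i\<in>{1..n}. real i \<le> r})"
proof -
  have sub: "{i\<in>{1..n}. real i \<le> r} \<subseteq> {1..nat \<lfloor>r\<rfloor>}" by (auto simp: le_nat_floor)
  have "card {i\<in>{1..n}. real i \<le> r} \<le> nat \<lfloor>r\<rfloor>"
    using card_mono[OF _ sub] by simp
  then show "real (card {i\<in>{1..n}. real i \<le> r}) \<le> r" if "0 \<le> r"
    using that by linarith
  show "r - 1 \<le> real (card {i\<in>{1..n}. real i \<le> r})" if "r \<le> real n"
  proof -
    have "{1..nat \<lfloor>r\<rfloor>} \<subseteq> {i\<in>{1..n}. real i \<le> r}"
    proof
      fix i assume i: "i \<in> {1..nat \<lfloor>r\<rfloor>}"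
      then have "real i \<le> r" by simp linarith
      then show "i \<in> {i\<in>{1..n}. real i \<le> r}" using i that by auto
    qed
    then have "nat \<lfloor>r\<rfloor> \<le> card {i\<in>{1..n}. real i \<le> r}" using card_mono[of "{i\<in>{1..n}. real i \<le> r}" "{1..nat \<lfloor>r\<rfloor>}"] by simp
    then show ?thesis by linarith
  qed
qed

context shortcut_family
begin

lemma cutoff_atI:
  assumes T: "\<And>n. 2 \<le> n \<Longrightarrow> 0 < T n"
    and late: "\<And>a \<delta>. 1 < a \<Longrightarrow> 0 < \<delta> \<Longrightarrow> eventually (\<lambda>n. d n (a * T n) \<le> \<delta>) sequentially"
    and early: "\<And>a \<delta>. 0 < a \<Longrightarrow> a < 1 \<Longrightarrow> 0 < \<delta> \<Longrightarrow> eventually (\<lambda>n. 1 - \<delta> \<le> d n (a * T n)) sequentially"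
  shows "tv_cutoff_c_at 2 X K \<mu> T"
  unfolding tv_cutoff_c_at_def d_def[symmetric]
proof (intro conjI allI impI)
  fix a :: real assume a: "1 < a"
  show "(\<lambda>n. d n (a * T n)) \<longlonglongrightarrow> 0"
  proof (rule tendstoI)
    fix e :: real assume e: "0 < e"
    then have "eventually (\<lambda>n. d n (a * T n) \<le> e / 2) sequentially" using late[OF a, of "e / 2"] by simp
    then show "eventually (\<lambda>n. dist (d n (a * T n)) 0 < e) sequentially"
      using eventually_ge_at_top[of 2]
    proof eventually_elim
      case (elim n)
      then show ?case using d_nonneg[of n "a * T n"] T[of n] a e by (simp add: dist_real_def)
    qed
  qed
next
  fix a :: real assume a: "0 < a \<and> a < 1"
  show "(\<lambda>n. d n (a * T n)) \<longlonglongrightarrow> 1"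
  proof (rule tendstoI)
    fix e :: real assume e: "0 < e"
    then have "eventually (\<lambda>n. 1 - e / 2 \<le> d n (a * T n)) sequentially" using early[of a "e / 2"] a by simp
    then show "eventually (\<lambda>n. dist (d n (a * T n)) 1 < e) sequentially"
      using eventually_ge_at_top[of 2]
    proof eventually_elim
      case (elim n)
      then show ?case using d_le_1[of n "a * T n"] T[of n] a e by (simp add: dist_real_def)
    qed
  qed
qed (use T in auto)

end

text \<open>Many coordinates of nearly minimal rate: the slowest coordinates through the shortcut need time
\<open>\<kappa> * n\<^sup>2\<close>, and a positive proportion of all coordinates would need about \<open>2 * \<kappa> * n\<^sup>2\<close> on the long route.\<close>

locale regular_rates = shortcut_family +
  fixes \<kappa> :: real
  assumes \<kappa>: "0 < \<kappa>"
    and q_limit: "(\<lambda>n. q n / real n) \<longlonglongrightarrow> \<kappa>"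
    and p_ge_1: "\<And>n i. 2 \<le> n \<Longrightarrow> i \<in> {1..n} \<Longrightarrow> 1 \<le> p n i"
    and p_near_1: "\<And>\<epsilon>. 0 < \<epsilon> \<Longrightarrow>
          \<exists>\<delta>>0. eventually (\<lambda>n. \<forall>i\<in>{1..n}. real i \<le> \<delta> * real n \<longrightarrow> p n i \<le> 1 + \<epsilon>) sequentially"
begin

text \<open>The factor \<open>m\<close> is \<open>1\<close> for the shortcut and \<open>2\<close> for the long route.\<close>

lemma clock_ge:
  assumes "0 < \<epsilon>"
  shows "eventually (\<lambda>n. \<forall>m\<ge>0. \<forall>t. (1 + \<epsilon>) * \<kappa> * m * (real n)\<^sup>2 \<le> t \<longrightarrow>
           (\<forall>i\<in>{1..n}. (1 + \<epsilon> / 2) * (m * real n) \<le> clock n t i)) sequentially"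
proof -
  have "(\<lambda>n. (1 + \<epsilon> / 2) * (q n / real n)) \<longlonglongrightarrow> (1 + \<epsilon> / 2) * \<kappa>"
    by (intro tendsto_intros q_limit)
  moreover have "(1 + \<epsilon> / 2) * \<kappa> < (1 + \<epsilon>) * \<kappa>" using assms \<kappa> by (intro mult_strict_right_mono) auto
  ultimately have "eventually (\<lambda>n. (1 + \<epsilon> / 2) * (q n / real n) < (1 + \<epsilon>) * \<kappa>) sequentially"
    by (rule order_tendstoD)
  then show ?thesis using eventually_ge_at_top[of 2]
  proof eventually_elim
    case (elim n)
    show ?case
    proof (intro allI impI ballI)
      fix m t :: real and i assume m: "0 \<le> m" and t: "(1 + \<epsilon>) * \<kappa> * m * (real n)\<^sup>2 \<le> t" and i: "i \<in> {1..n}"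
      have q: "0 < q n" using q_pos elim by simp
      have "0 \<le> (1 + \<epsilon>) * \<kappa> * m * (real n)\<^sup>2" using assms \<kappa> m by simp
      then have t0: "0 \<le> t" using t by linarith
      have "(1 + \<epsilon> / 2) * (m * real n) = ((1 + \<epsilon> / 2) * (q n / real n)) * (m * (real n)\<^sup>2) / q n"
        using q elim by (simp add: power2_eq_square)
      also have "\<dots> \<le> ((1 + \<epsilon>) * \<kappa>) * (m * (real n)\<^sup>2) / q n"
        using elim m q by (intro divide_right_mono mult_right_mono) auto
      also have "\<dots> = (1 + \<epsilon>) * \<kappa> * m * (real n)\<^sup>2 / q n" by (simp only: mult.assoc)
      also have "\<dots> \<le> t / q n" using t q by (intro divide_right_mono) auto
      also have "\<dots> \<le> t / q n * p n i"
        using p_ge_1[of n i] i elim t0 q mult_left_mono[of 1 "p n i" "t / q n"] by simp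
      finally show "(1 + \<epsilon> / 2) * (m * real n) \<le> clock n t i" by (simp add: clock_def)
    qed
  qed
qed

lemma clock_le:
  assumes "0 < \<epsilon>" "\<epsilon> < 1"
  shows "\<exists>\<delta>>0. \<delta> \<le> 1 \<and> eventually (\<lambda>n. \<forall>m\<ge>0. \<forall>t\<ge>0. t \<le> (1 - \<epsilon>) * \<kappa> * m * (real n)\<^sup>2 \<longrightarrow>
           (\<forall>i\<in>{1..n}. real i \<le> \<delta> * real n \<longrightarrow> clock n t i \<le> (1 - \<epsilon> / 2) * (m * real n))) sequentially"
proof -
  obtain \<delta> where \<delta>: "0 < \<delta>"
    "eventually (\<lambda>n. \<forall>i\<in>{1..n}. real i \<le> \<delta> * real n \<longrightarrow> p n i \<le> 1 + \<epsilon> / 4) sequentially"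
    using p_near_1[of "\<epsilon> / 4"] assms by auto
  have "(\<lambda>n. (1 - \<epsilon> / 2) * (q n / real n)) \<longlonglongrightarrow> (1 - \<epsilon> / 2) * \<kappa>"
    by (intro tendsto_intros q_limit)
  moreover have "(1 - \<epsilon>) * (1 + \<epsilon> / 4) * \<kappa> < (1 - \<epsilon> / 2) * \<kappa>"
    using assms \<kappa> mult_pos_pos[OF assms(1) assms(1)]
    by (intro mult_strict_right_mono) (auto simp: algebra_simps intro!: add_pos_pos)
  ultimately have "eventually (\<lambda>n. (1 - \<epsilon>) * (1 + \<epsilon> / 4) * \<kappa> < (1 - \<epsilon> / 2) * (q n / real n)) sequentially"
    by (rule order_tendstoD)
  with \<delta>(2) have "eventually (\<lambda>n. \<forall>m\<ge>0. \<forall>t\<ge>0. t \<le> (1 - \<epsilon>) * \<kappa> * m * (real n)\<^sup>2 \<longrightarrow>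
           (\<forall>i\<in>{1..n}. real i \<le> min \<delta> 1 * real n \<longrightarrow> clock n t i \<le> (1 - \<epsilon> / 2) * (m * real n))) sequentially"
    using eventually_ge_at_top[of 2]
  proof eventually_elim
    case (elim n)
    show ?case
    proof (intro allI impI ballI)
      fix m t :: real and i assume m: "0 \<le> m" and t0: "0 \<le> t" and t: "t \<le> (1 - \<epsilon>) * \<kappa> * m * (real n)\<^sup>2"
        and i: "i \<in> {1..n}" "real i \<le> min \<delta> 1 * real n"
      have q: "0 < q n" using q_pos elim by simp
      have "min \<delta> 1 * real n \<le> \<delta> * real n" by (intro mult_right_mono) auto
      with i(2) have "real i \<le> \<delta> * real n" by (rule order.trans)
      then have p: "p n i \<le> 1 + \<epsilon> / 4" using elim(1) i(1) by blast
      have "t * p n i \<le> ((1 - \<epsilon>) * \<kappa> * m * (real n)\<^sup>2) * (1 + \<epsilon> / 4)"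
        using p t t0 p_ge_1[of n i] i elim assms by (intro mult_mono) auto
      also have "\<dots> = ((1 - \<epsilon>) * (1 + \<epsilon> / 4) * \<kappa>) * (m * (real n)\<^sup>2)" by (simp only: mult_ac)
      also have "\<dots> \<le> ((1 - \<epsilon> / 2) * (q n / real n)) * (m * (real n)\<^sup>2)"
        using elim m by (intro mult_right_mono) auto
      also have "\<dots> = (1 - \<epsilon> / 2) * (m * real n) * q n" using elim by (simp add: power2_eq_square)
      finally have "t * p n i / q n \<le> (1 - \<epsilon> / 2) * (m * real n)" using q by (simp add: pos_divide_le_eq)
      then show "clock n t i \<le> (1 - \<epsilon> / 2) * (m * real n)" by (simp add: clock_def)
    qed
  qed
  then show ?thesis using \<delta>(1) by (intro exI[of _ "min \<delta> 1"]) auto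
qed

lemma late_fast:
  assumes "0 < \<epsilon>" "0 < \<delta>"
  shows "eventually (\<lambda>n. \<forall>t. (1 + \<epsilon>) * \<kappa> * (real n)\<^sup>2 \<le> t \<longrightarrow>
           d n t \<le> 1 - exp (- 2 * C * real n * real n powr (- \<beta>)) + \<delta>) sequentially"
  using clock_ge[OF assms(1)] d_upper[OF half_gt_zero[OF assms(1)] assms(2)]
proof eventually_elim
  case (elim n)
  show ?case
  proof (intro allI impI)
    fix t assume t: "(1 + \<epsilon>) * \<kappa> * (real n)\<^sup>2 \<le> t"
    have "0 \<le> (1 + \<epsilon>) * \<kappa> * (real n)\<^sup>2" using assms \<kappa> by simp
    then have "0 \<le> t" using t by linarith
    moreover have "\<forall>i\<in>{1..n}. (1 + \<epsilon> / 2) * real n \<le> clock n t i"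
      using elim(1)[rule_format, of 1 t] t by simp
    ultimately show "d n t \<le> 1 - exp (- 2 * C * real n * real n powr (- \<beta>)) + \<delta>"
      using elim(2)[rule_format, of t "{1..n}"] assms by auto
  qed
qed

lemma late_slow:
  assumes "0 < \<epsilon>" "0 < \<delta>"
  shows "eventually (\<lambda>n. \<forall>t. (1 + \<epsilon>) * (2 * \<kappa> * (real n)\<^sup>2) \<le> t \<longrightarrow> d n t \<le> \<delta>) sequentially"
  using clock_ge[OF assms(1)] d_upper[OF half_gt_zero[OF assms(1)] assms(2)]
proof eventually_elim
  case (elim n)
  show ?case
  proof (intro allI impI)
    fix t assume t: "(1 + \<epsilon>) * (2 * \<kappa> * (real n)\<^sup>2) \<le> t"
    have "0 \<le> (1 + \<epsilon>) * (2 * \<kappa> * (real n)\<^sup>2)" using assms \<kappa> by simp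
    then have "0 \<le> t" using t by linarith
    moreover have "(1 + \<epsilon> / 2) * (2 * real n) \<le> clock n t i" if "i \<in> {1..n}" for i
    proof (rule elim(1)[rule_format])
      have "(1 + \<epsilon>) * \<kappa> * 2 * (real n)\<^sup>2 = (1 + \<epsilon>) * (2 * \<kappa> * (real n)\<^sup>2)" by simp
      then show "(1 + \<epsilon>) * \<kappa> * 2 * (real n)\<^sup>2 \<le> t" using t by simp
    qed (use that in simp_all)
    ultimately show "d n t \<le> \<delta>"
      using elim(2)[rule_format, of t "{}"] assms by auto
  qed
qed

lemma early_fast:
  assumes "0 < \<epsilon>" "\<epsilon> < 1" "0 < \<delta>"
  shows "eventually (\<lambda>n. \<forall>t\<ge>0. t \<le> (1 - \<epsilon>) * \<kappa> * (real n)\<^sup>2 \<longrightarrow> 1 - \<delta> \<le> d n t) sequentially"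
proof -
  obtain r where r: "0 < r" and cl:
    "eventually (\<lambda>n. \<forall>m\<ge>0. \<forall>t\<ge>0. t \<le> (1 - \<epsilon>) * \<kappa> * m * (real n)\<^sup>2 \<longrightarrow>
       (\<forall>i\<in>{1..n}. real i \<le> r * real n \<longrightarrow> clock n t i \<le> (1 - \<epsilon> / 2) * (m * real n))) sequentially"
    using clock_le[OF assms(1,2)] by blast
  note cl
  moreover have "eventually (\<lambda>n. 1 \<le> r * real n) sequentially" using r by real_asymp
  moreover have "eventually (\<lambda>n. \<forall>t\<ge>0. \<forall>i\<in>{1..n}. clock n t i \<le> (1 - \<epsilon> / 2) * real n \<longrightarrow> 1 - \<delta> \<le> d n t) sequentially"
    using assms by (intro d_lower_fast) auto
  moreover have "eventually (\<lambda>n. 2 \<le> n) sequentially" by (rule eventually_ge_at_top)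
  ultimately show ?thesis
  proof eventually_elim
    case (elim n)
    show ?case
    proof (intro allI impI)
      fix t :: real assume t: "0 \<le> t" "t \<le> (1 - \<epsilon>) * \<kappa> * (real n)\<^sup>2"
      then have "clock n t 1 \<le> (1 - \<epsilon> / 2) * (1 * real n)"
        using elim(1)[rule_format, of 1 t 1] elim(2,4) by simp
      then show "1 - \<delta> \<le> d n t" using elim(3)[rule_format, of t 1] t elim(4) by simp
    qed
  qed
qed

lemma early_slow:
  assumes "0 < \<epsilon>" "\<epsilon> < 1"
  shows "\<exists>r>0. \<forall>\<delta>>0. eventually (\<lambda>n. \<forall>t\<ge>0. t \<le> (1 - \<epsilon>) * (2 * \<kappa> * (real n)\<^sup>2) \<longrightarrow>
           1 - exp (- (r * (real n * real n powr (- \<beta>)))) - \<delta> \<le> d n t) sequentially"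
proof -
  obtain r where r: "0 < r" "r \<le> 1" and cl:
    "eventually (\<lambda>n. \<forall>m\<ge>0. \<forall>t\<ge>0. t \<le> (1 - \<epsilon>) * \<kappa> * m * (real n)\<^sup>2 \<longrightarrow>
       (\<forall>i\<in>{1..n}. real i \<le> r * real n \<longrightarrow> clock n t i \<le> (1 - \<epsilon> / 2) * (m * real n))) sequentially"
    using clock_le[OF assms] by blast
  have "eventually (\<lambda>n. \<forall>t\<ge>0. t \<le> (1 - \<epsilon>) * (2 * \<kappa> * (real n)\<^sup>2) \<longrightarrow>
           1 - exp (- (r / (8 * C) * (real n * real n powr (- \<beta>)))) - \<delta> \<le> d n t) sequentially"
    if \<delta>: "0 < \<delta>" for \<delta>
  proof -
    have "eventually (\<lambda>n. r * real n / 2 \<le> r * real n - 1) sequentially" using r by real_asymp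
    moreover have "eventually (\<lambda>n. \<forall>t\<ge>0. \<forall>J\<subseteq>{1..n}. (\<forall>i\<in>J. clock n t i \<le> (1 - \<epsilon> / 2) * (2 * real n)) \<longrightarrow>
           1 - exp (- (real (card J) * real n powr (- \<beta>) / (4 * C))) - \<delta> \<le> d n t) sequentially"
      using assms \<delta> by (intro d_lower_slow) auto
    ultimately show ?thesis using cl
    proof eventually_elim
      case (elim n)
      show ?case
      proof (intro allI impI)
        fix t :: real assume t: "0 \<le> t" "t \<le> (1 - \<epsilon>) * (2 * \<kappa> * (real n)\<^sup>2)"
        define J where "J = {i\<in>{1..n}. real i \<le> r * real n}"
        have "r * real n \<le> 1 * real n" using r by (intro mult_right_mono) auto
        then have J: "r * real n / 2 \<le> real (card J)"
          using card_below_ge[of "r * real n" n] elim(1) by (simp add: J_def)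
        have J_sub: "J \<subseteq> {1..n}" by (auto simp: J_def)
        have in_time: "clock n t i \<le> (1 - \<epsilon> / 2) * (2 * real n)" if "i \<in> J" for i
        proof (rule elim(3)[rule_format])
          have "(1 - \<epsilon>) * \<kappa> * 2 * (real n)\<^sup>2 = (1 - \<epsilon>) * (2 * \<kappa> * (real n)\<^sup>2)" by simp
          then show "t \<le> (1 - \<epsilon>) * \<kappa> * 2 * (real n)\<^sup>2" using t(2) by simp
        qed (use t that in \<open>auto simp: J_def\<close>)
        have "1 - exp (- (real (card J) * real n powr (- \<beta>) / (4 * C))) - \<delta> \<le> d n t"
          by (rule elim(2)[rule_format, OF t(1) J_sub in_time])
        moreover have "(r * real n / 2) * real n powr (- \<beta>) / (4 * C) \<le> real (card J) * real n powr (- \<beta>) / (4 * C)"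
          using J C by (intro divide_right_mono mult_right_mono) auto
        then have "exp (- (real (card J) * real n powr (- \<beta>) / (4 * C)))
            \<le> exp (- (r / (8 * C) * (real n * real n powr (- \<beta>))))"
          by (simp add: field_simps)
        ultimately show "1 - exp (- (r / (8 * C) * (real n * real n powr (- \<beta>)))) - \<delta> \<le> d n t" by linarith
      qed
    qed
  qed
  then show ?thesis using r C by (intro exI[of _ "r / (8 * C)"]) auto
qed

lemma cutoff_fast:
  assumes "1 < \<beta>"
  shows "tv_cutoff_c_at 2 X K \<mu> (\<lambda>n. \<kappa> * (real n)\<^sup>2)"
proof (rule cutoff_atI)
  fix a \<delta> :: real assume a: "1 < a" and \<delta>: "0 < \<delta>"
  have "(\<lambda>n. 1 - exp (- 2 * C * real n * real n powr (- \<beta>))) \<longlonglongrightarrow> 0"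
    using assms C by real_asymp
  then have "eventually (\<lambda>n. 1 - exp (- 2 * C * real n * real n powr (- \<beta>)) < \<delta> / 2) sequentially"
    using \<delta> by (intro order_tendstoD(2)[of _ 0]) auto
  moreover have "eventually (\<lambda>n. \<forall>t. (1 + (a - 1)) * \<kappa> * (real n)\<^sup>2 \<le> t \<longrightarrow>
           d n t \<le> 1 - exp (- 2 * C * real n * real n powr (- \<beta>)) + \<delta> / 2) sequentially"
    using a \<delta> by (intro late_fast) auto
  ultimately show "eventually (\<lambda>n. d n (a * (\<kappa> * (real n)\<^sup>2)) \<le> \<delta>) sequentially"
  proof eventually_elim
    case (elim n)
    show ?case using elim(1) elim(2)[rule_format, of "a * (\<kappa> * (real n)\<^sup>2)"] by (simp add: mult.assoc)
  qed
next
  fix a \<delta> :: real assume a: "0 < a" "a < 1" and \<delta>: "0 < \<delta>"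
  have "eventually (\<lambda>n. \<forall>t\<ge>0. t \<le> (1 - (1 - a)) * \<kappa> * (real n)\<^sup>2 \<longrightarrow> 1 - \<delta> \<le> d n t) sequentially"
    using a \<delta> by (intro early_fast) auto
  then show "eventually (\<lambda>n. 1 - \<delta> \<le> d n (a * (\<kappa> * (real n)\<^sup>2))) sequentially"
    using a \<kappa> by (elim eventually_mono) (simp add: mult.assoc)
qed (use \<kappa> in auto)

lemma cutoff_slow:
  assumes "\<beta> < 1"
  shows "tv_cutoff_c_at 2 X K \<mu> (\<lambda>n. 2 * \<kappa> * (real n)\<^sup>2)"
proof (rule cutoff_atI)
  fix a \<delta> :: real assume a: "1 < a" and \<delta>: "0 < \<delta>"
  have "eventually (\<lambda>n. \<forall>t. (1 + (a - 1)) * (2 * \<kappa> * (real n)\<^sup>2) \<le> t \<longrightarrow> d n t \<le> \<delta>) sequentially"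
    using a \<delta> by (intro late_slow) auto
  then show "eventually (\<lambda>n. d n (a * (2 * \<kappa> * (real n)\<^sup>2)) \<le> \<delta>) sequentially"
    by (elim eventually_mono) simp
next
  fix a \<delta> :: real assume a: "0 < a" "a < 1" and \<delta>: "0 < \<delta>"
  obtain r where r: "0 < r" and early: "\<And>\<delta>. 0 < \<delta> \<Longrightarrow>
      eventually (\<lambda>n. \<forall>t\<ge>0. t \<le> (1 - (1 - a)) * (2 * \<kappa> * (real n)\<^sup>2) \<longrightarrow>
           1 - exp (- (r * (real n * real n powr (- \<beta>)))) - \<delta> \<le> d n t) sequentially"
    using early_slow[of "1 - a"] a by auto
  have "(\<lambda>n. exp (- (r * (real n * real n powr (- \<beta>))))) \<longlonglongrightarrow> 0"
    using assms r by real_asymp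
  then have "eventually (\<lambda>n. exp (- (r * (real n * real n powr (- \<beta>)))) < \<delta> / 2) sequentially"
    using \<delta> by (intro order_tendstoD(2)[of _ 0]) auto
  moreover note early[OF half_gt_zero[OF \<delta>]]
  ultimately show "eventually (\<lambda>n. 1 - \<delta> \<le> d n (a * (2 * \<kappa> * (real n)\<^sup>2))) sequentially"
  proof eventually_elim
    case (elim n)
    have "0 \<le> a * (2 * \<kappa> * (real n)\<^sup>2)" using a \<kappa> by simp
    then show ?case using elim(1) elim(2)[rule_format, of "a * (2 * \<kappa> * (real n)\<^sup>2)"] by simp
  qed
qed (use \<kappa> in auto)

text \<open>For \<open>\<beta> = 1\<close> the distance is bounded away from \<open>1\<close> from time \<open>5 / 4 * \<kappa> * n\<^sup>2\<close> on, and away from \<open>0\<close>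
until time \<open>7 / 4 * \<kappa> * n\<^sup>2\<close>.  A cutoff time \<open>T\<close> would have \<open>5 / 6 * T\<close> below the former time and
\<open>7 / 6 * T\<close> above the latter; both comparisons have the threshold \<open>3 / 2 * \<kappa> * n\<^sup>2\<close> for \<open>T\<close> and exclude
each other.\<close>

lemma no_cutoff:
  assumes "\<beta> = 1"
  shows "\<not> tv_cutoff_c 2 X K \<mu>"
proof
  assume "tv_cutoff_c 2 X K \<mu>"
  then obtain T where T: "tv_cutoff_c_at 2 X K \<mu> T" by (auto simp: tv_cutoff_c_def)
  obtain r where r: "0 < r" and early: "\<And>\<delta>. 0 < \<delta> \<Longrightarrow>
      eventually (\<lambda>n. \<forall>t\<ge>0. t \<le> (1 - 1 / 8) * (2 * \<kappa> * (real n)\<^sup>2) \<longrightarrow>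
           1 - exp (- (r * (real n * real n powr (- \<beta>)))) - \<delta> \<le> d n t) sequentially"
    using early_slow[of "1 / 8"] by auto
  define u where "u = exp (- 2 * C)"
  define l where "l = 1 - exp (- r)"
  have u: "0 < u" and l: "0 < l" using r by (auto simp: u_def l_def)
  have "(\<lambda>n. d n (5 / 6 * T n)) \<longlonglongrightarrow> 1"
    using T unfolding tv_cutoff_c_at_def d_def by (elim conjE allE[of _ "5 / 6"]) simp
  then have above: "eventually (\<lambda>n. 1 - u / 2 < d n (5 / 6 * T n)) sequentially"
    by (rule order_tendstoD) (use u in simp)
  have "(\<lambda>n. d n (7 / 6 * T n)) \<longlonglongrightarrow> 0"
    using T unfolding tv_cutoff_c_at_def d_def by (elim conjE allE[of _ "7 / 6"]) simp
  then have "eventually (\<lambda>n. d n (7 / 6 * T n) < l / 2) sequentially"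
    by (rule order_tendstoD) (use l in simp)
  note above this
  moreover have "eventually (\<lambda>n. \<forall>t. (1 + 1 / 4) * \<kappa> * (real n)\<^sup>2 \<le> t \<longrightarrow>
           d n t \<le> 1 - exp (- 2 * C * real n * real n powr (- \<beta>)) + u / 2) sequentially"
    using u by (intro late_fast) auto
  moreover note early[OF half_gt_zero[OF l]]
  moreover have "eventually (\<lambda>n. 2 \<le> n) sequentially" by (rule eventually_ge_at_top)
  ultimately have "eventually (\<lambda>_ :: nat. False) sequentially"
  proof eventually_elim
    case (elim n)
    have n: "real n * real n powr (- \<beta>) = 1" using assms elim by (simp add: powr_minus)
    have "5 / 6 * T n < (1 + 1 / 4) * \<kappa> * (real n)\<^sup>2"
    proof (rule ccontr)
      assume "\<not> ?thesis"
      then have "d n (5 / 6 * T n) \<le> 1 - exp (- 2 * C * (real n * real n powr (- \<beta>))) + u / 2"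
        using elim(3)[rule_format, of "5 / 6 * T n"] by (simp add: mult.assoc)
      then show False using elim(1) unfolding n by (simp add: u_def)
    qed
    moreover have "(1 - 1 / 8) * (2 * \<kappa> * (real n)\<^sup>2) < 7 / 6 * T n"
    proof (rule ccontr)
      assume *: "\<not> ?thesis"
      have "0 < T n" using T elim by (simp add: tv_cutoff_c_at_def)
      then have "1 - exp (- (r * (real n * real n powr (- \<beta>)))) - l / 2 \<le> d n (7 / 6 * T n)"
        using elim(4)[rule_format, of "7 / 6 * T n"] * by simp
      moreover have "1 - exp (- (r * (real n * real n powr (- \<beta>)))) = l" unfolding n by (simp add: l_def)
      ultimately show False using elim(2) by (simp add: field_simps)
    qed
    ultimately show False by simp
  qed
  then show False by simp
qed

lemma cutoff_regular_rates:
  "(tv_cutoff_c 2 X K \<mu> \<longleftrightarrow> \<beta> \<noteq> 1) \<and>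
   (\<beta> < 1 \<longrightarrow> tv_cutoff_c_at 2 X K \<mu> (\<lambda>n. 2 * \<kappa> * (real n)\<^sup>2)) \<and>
   (\<beta> > 1 \<longrightarrow> tv_cutoff_c_at 2 X K \<mu> (\<lambda>n. \<kappa> * (real n)\<^sup>2))"
  using cutoff_slow cutoff_fast no_cutoff
  by (cases \<beta> "1 :: real" rule: linorder_cases) (auto simp: tv_cutoff_c_def)

end

context shortcut_family
begin

text \<open>The index \<open>n powr \<sigma>\<close> separates the coordinates: for \<open>\<sigma> < min \<beta> 1\<close> those below it all use the shortcut
with high probability, as their number times \<open>n powr - \<beta>\<close> tends to \<open>0\<close>, while those above it have rate at least \<open>1 + \<sigma>\<close>.  For
\<open>\<beta> < \<sigma> < 1\<close> many of those below it take the long route, at rate at most \<open>1 + \<sigma>\<close>.\<close>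

lemma cutoff_logarithmic_rates:
  assumes p: "\<And>n i. 2 \<le> n \<Longrightarrow> i \<in> {1..n} \<Longrightarrow> p n i = 1 + ln (real i) / ln (real n)"
    and q_limit: "(\<lambda>n. q n / real n) \<longlonglongrightarrow> 2"
  shows "tv_cutoff_c_at 2 X K \<mu> (\<lambda>n. 4 * (real n)\<^sup>2 / (1 + min \<beta> 1))"
proof -
  define \<gamma> where "\<gamma> = min \<beta> 1"
  have \<gamma>: "0 < \<gamma>" "\<gamma> \<le> 1" "\<gamma> \<le> \<beta>" using \<beta> by (auto simp: \<gamma>_def)
  have p_le: "p n i \<le> 1 + \<sigma>" if "2 \<le> n" "i \<in> {1..n}" "real i \<le> real n powr \<sigma>" for n i \<sigma>
  proof -
    have "ln (real i) \<le> ln (real n powr \<sigma>)" using that by (subst ln_le_cancel_iff) auto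
    also have "\<dots> = \<sigma> * ln (real n)" using that by (simp add: ln_powr)
    finally show ?thesis using that p[of n i] by (simp add: pos_divide_le_eq)
  qed
  have p_ge: "1 + \<sigma> \<le> p n i" if "2 \<le> n" "i \<in> {1..n}" "real n powr \<sigma> \<le> real i" for n i \<sigma>
  proof -
    have "0 < real n powr \<sigma>" using that by simp
    then have "ln (real n powr \<sigma>) \<le> ln (real i)" using that by (subst ln_le_cancel_iff) auto
    moreover have "ln (real n powr \<sigma>) = \<sigma> * ln (real n)" using that by (simp add: ln_powr)
    ultimately show ?thesis using that p[of n i] by (simp add: pos_le_divide_eq)
  qed
  have clock: "clock n (a * (4 * (real n)\<^sup>2 / (1 + \<gamma>))) i = (a * 4 * p n i / (1 + \<gamma>) * real n) / (q n / real n)"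
    if "2 \<le> n" for n a i
    using that q_pos[of n] \<gamma> by (simp add: clock_def power2_eq_square)
  have q_le: "eventually (\<lambda>n. (1 + \<epsilon>) * (q n / real n) \<le> 2 * (1 + 2 * \<epsilon>)) sequentially"
    if "0 < \<epsilon>" for \<epsilon>
  proof -
    have "(\<lambda>n. (1 + \<epsilon>) * (q n / real n)) \<longlonglongrightarrow> (1 + \<epsilon>) * 2" by (intro tendsto_intros q_limit)
    then have "eventually (\<lambda>n. (1 + \<epsilon>) * (q n / real n) < 2 * (1 + 2 * \<epsilon>)) sequentially"
      by (rule order_tendstoD) (use that in simp)
    then show ?thesis by (elim eventually_mono) simp
  qed
  have q_ge: "eventually (\<lambda>n. 2 * (1 - 2 * \<epsilon>) \<le> (1 - \<epsilon>) * (q n / real n)) sequentially"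
    if "0 < \<epsilon>" for \<epsilon>
  proof -
    have "(\<lambda>n. (1 - \<epsilon>) * (q n / real n)) \<longlonglongrightarrow> (1 - \<epsilon>) * 2" by (intro tendsto_intros q_limit)
    then have "eventually (\<lambda>n. 2 * (1 - 2 * \<epsilon>) < (1 - \<epsilon>) * (q n / real n)) sequentially"
      by (rule order_tendstoD) (use that in simp)
    then show ?thesis by (elim eventually_mono) simp
  qed
  have q_pos': "0 < q n / real n" if "2 \<le> n" for n using q_pos[of n] that by simp
  have "tv_cutoff_c_at 2 X K \<mu> (\<lambda>n. 4 * (real n)\<^sup>2 / (1 + \<gamma>))"
  proof (rule cutoff_atI)
    fix a \<delta> :: real assume a: "1 < a" and \<delta>: "0 < \<delta>"
    have "1 * (1 + \<gamma>) < a * (1 + \<gamma>)" using a \<gamma> by (intro mult_strict_right_mono) auto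
    then have "(1 + \<gamma>) / a < 1 + \<gamma>" using a by (simp add: pos_divide_less_eq mult.commute)
    then have "max 0 ((1 + \<gamma>) / a - 1) < \<gamma>" using \<gamma> by simp
    \<comment> \<open>As \<open>a * (1 + \<sigma>) > 1 + \<gamma>\<close>, coordinates of rate \<open>1 + \<sigma>\<close> complete the long route in time; as \<open>\<sigma> < \<beta>\<close>, those below \<open>n powr \<sigma>\<close> do not take it.\<close>
    then obtain \<sigma> where \<sigma>: "0 < \<sigma>" "\<sigma> < \<gamma>" "(1 + \<gamma>) / a - 1 < \<sigma>" by (metis dense max_less_iff_conj)
    define \<epsilon> where "\<epsilon> = (a * (1 + \<sigma>) / (1 + \<gamma>) - 1) / 2"
    have "1 + \<gamma> < a * (1 + \<sigma>)" using \<sigma>(3) a by (simp add: field_simps)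
    then have \<epsilon>: "0 < \<epsilon>" "1 + 2 * \<epsilon> = a * (1 + \<sigma>) / (1 + \<gamma>)" using \<gamma> by (auto simp: \<epsilon>_def field_simps)
    have "(\<lambda>n. 1 - exp (- 2 * C * real n powr \<sigma> * real n powr (- \<beta>))) \<longlonglongrightarrow> 0"
      using \<sigma> \<gamma> C by real_asymp
    then have "eventually (\<lambda>n. 1 - exp (- 2 * C * real n powr \<sigma> * real n powr (- \<beta>)) < \<delta> / 2) sequentially"
      by (rule order_tendstoD) (use \<delta> in simp)
    moreover note q_le[OF \<epsilon>(1)] d_upper[OF \<epsilon>(1) half_gt_zero[OF \<delta>]]
    moreover have "eventually (\<lambda>n. 2 \<le> n) sequentially" by (rule eventually_ge_at_top)
    ultimately show "eventually (\<lambda>n. d n (a * (4 * (real n)\<^sup>2 / (1 + \<gamma>))) \<le> \<delta>) sequentially"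
    proof eventually_elim
      case (elim n)
      define t where "t = a * (4 * (real n)\<^sup>2 / (1 + \<gamma>))"
      define F where "F = {i\<in>{1..n}. real i \<le> real n powr \<sigma>}"
      have t: "0 \<le> t" using a \<gamma> by (simp add: t_def)
      have reach: "(1 + \<epsilon>) * m \<le> clock n t i"
        if "i \<in> {1..n}" "2 * (1 + 2 * \<epsilon>) * m \<le> a * 4 * p n i / (1 + \<gamma>) * real n" "0 \<le> m" for i m
      proof -
        have "(1 + \<epsilon>) * m * (q n / real n) = (1 + \<epsilon>) * (q n / real n) * m" by (simp only: mult_ac)
        also have "\<dots> \<le> 2 * (1 + 2 * \<epsilon>) * m" using elim(2) that(3) by (rule mult_right_mono)
        also have "\<dots> \<le> a * 4 * p n i / (1 + \<gamma>) * real n" by (rule that(2))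
        finally show ?thesis
          unfolding t_def clock[OF elim(4)] pos_le_divide_eq[OF q_pos'[OF elim(4)]] .
      qed
      have F_sub: "F \<subseteq> {1..n}" by (auto simp: F_def)
      have fast: "(1 + \<epsilon>) * real n \<le> clock n t i" if i: "i \<in> F" for i
      proof (rule reach)
        have "1 \<le> p n i" using p_ge[of n i 0] i elim by (simp add: F_def)
        have "2 * (a * (1 + \<sigma>)) \<le> 2 * (a * 2)" using a \<sigma> \<gamma> by (intro mult_left_mono) auto
        also have "\<dots> \<le> a * 4 * p n i" using a \<open>1 \<le> p n i\<close> by simp
        finally have "2 * (a * (1 + \<sigma>)) / (1 + \<gamma>) * real n \<le> a * 4 * p n i / (1 + \<gamma>) * real n"
          using \<gamma> by (intro mult_right_mono divide_right_mono) auto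
        then show "2 * (1 + 2 * \<epsilon>) * real n \<le> a * 4 * p n i / (1 + \<gamma>) * real n" by (simp add: \<epsilon>(2))
      qed (use i in \<open>auto simp: F_def\<close>)
      have slow: "(1 + \<epsilon>) * (2 * real n) \<le> clock n t i" if i: "i \<in> {1..n} - F" for i
      proof (rule reach)
        have "real n powr \<sigma> \<le> real i" using i by (auto simp: F_def)
        then have "1 + \<sigma> \<le> p n i" using p_ge[of n i \<sigma>] i elim by auto
        then have "4 * a * (1 + \<sigma>) \<le> 4 * a * p n i" using a by (intro mult_left_mono) auto
        then have "4 * a * (1 + \<sigma>) / (1 + \<gamma>) * real n \<le> 4 * a * p n i / (1 + \<gamma>) * real n"
          using \<gamma> by (intro mult_right_mono divide_right_mono) auto
        moreover have "2 * (1 + 2 * \<epsilon>) * (2 * real n) = 4 * a * (1 + \<sigma>) / (1 + \<gamma>) * real n"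
          unfolding \<epsilon>(2) by simp
        ultimately show "2 * (1 + 2 * \<epsilon>) * (2 * real n) \<le> a * 4 * p n i / (1 + \<gamma>) * real n"
          by (simp only: mult.commute[of a 4])
      qed (use i in auto)
      have card: "2 * C * real (card F) * real n powr (- \<beta>) \<le> 2 * C * real n powr \<sigma> * real n powr (- \<beta>)"
        using card_below_le[of "real n powr \<sigma>" n] C by (intro mult_right_mono mult_left_mono) (auto simp: F_def)
      have "d n t \<le> 1 - exp (- 2 * C * real (card F) * real n powr (- \<beta>)) + \<delta> / 2"
        by (rule elim(3)[rule_format, OF t F_sub fast slow])
      moreover have "1 - exp (- 2 * C * real (card F) * real n powr (- \<beta>))
          \<le> 1 - exp (- 2 * C * real n powr \<sigma> * real n powr (- \<beta>))" using card by simp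
      ultimately show ?case using elim(1) unfolding t_def by linarith
    qed
  next
    fix a \<delta> :: real assume a: "0 < a" "a < 1" and \<delta>: "0 < \<delta>"
    show "eventually (\<lambda>n. 1 - \<delta> \<le> d n (a * (4 * (real n)\<^sup>2 / (1 + \<gamma>)))) sequentially"
    proof (cases "\<beta> < 1")
      case True
      then have \<gamma>\<beta>: "\<gamma> = \<beta>" by (simp add: \<gamma>_def)
      have "a * (1 + \<beta>) < 1 * (1 + \<beta>)" using a \<beta> by (intro mult_strict_right_mono) auto
      then have "1 + \<beta> < (1 + \<beta>) / a" using a by (simp add: pos_less_divide_eq mult.commute)
      then have "\<beta> < min 1 ((1 + \<beta>) / a - 1)" using True by simp
      \<comment> \<open>As \<open>a * (1 + \<sigma>) < 1 + \<beta>\<close>, coordinates of rate \<open>1 + \<sigma>\<close> do not complete the long route in time; as \<open>\<sigma> > \<beta>\<close>, many of those below \<open>n powr \<sigma>\<close> take it.\<close>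
      then obtain \<sigma> where \<sigma>: "\<beta> < \<sigma>" "\<sigma> < 1" "\<sigma> < (1 + \<beta>) / a - 1" by (metis dense min_less_iff_conj)
      define \<epsilon> where "\<epsilon> = (1 - a * (1 + \<sigma>) / (1 + \<gamma>)) / 2"
      have "a * (1 + \<sigma>) < 1 + \<gamma>" using \<sigma>(3) a by (simp add: field_simps \<gamma>\<beta>)
      then have \<epsilon>: "0 < \<epsilon>" "1 - 2 * \<epsilon> = a * (1 + \<sigma>) / (1 + \<gamma>)" using \<gamma> by (auto simp: \<epsilon>_def field_simps)
      moreover have "0 < a * (1 + \<sigma>) / (1 + \<gamma>)" using a \<sigma> \<beta> \<gamma> by simp
      ultimately have "\<epsilon> < 1" by linarith
      have "(\<lambda>n. exp (- ((real n powr \<sigma> - 1) * real n powr (- \<beta>) / (4 * C)))) \<longlonglongrightarrow> 0"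
        using \<sigma> \<beta> C by real_asymp
      then have "eventually (\<lambda>n. exp (- ((real n powr \<sigma> - 1) * real n powr (- \<beta>) / (4 * C))) < \<delta> / 2) sequentially"
        by (rule order_tendstoD) (use \<delta> in simp)
      moreover note q_ge[OF \<epsilon>(1)] d_lower_slow[OF \<epsilon>(1) \<open>\<epsilon> < 1\<close> half_gt_zero[OF \<delta>]]
      moreover have "eventually (\<lambda>n. 2 \<le> n) sequentially" by (rule eventually_ge_at_top)
      ultimately show ?thesis
      proof eventually_elim
        case (elim n)
        define t where "t = a * (4 * (real n)\<^sup>2 / (1 + \<gamma>))"
        define J where "J = {i\<in>{1..n}. real i \<le> real n powr \<sigma>}"
        have t: "0 \<le> t" using a \<gamma> by (simp add: t_def)
        have J_sub: "J \<subseteq> {1..n}" by (auto simp: J_def)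
        have in_time: "clock n t i \<le> (1 - \<epsilon>) * (2 * real n)" if i: "i \<in> J" for i
        proof -
          have "p n i \<le> 1 + \<sigma>" using p_le[of n i \<sigma>] i elim by (simp add: J_def)
          then have "4 * a * p n i \<le> 4 * a * (1 + \<sigma>)" using a by (intro mult_left_mono) auto
          then have "4 * a * p n i / (1 + \<gamma>) * real n \<le> 4 * a * (1 + \<sigma>) / (1 + \<gamma>) * real n"
            using \<gamma> by (intro mult_right_mono divide_right_mono) auto
          also have "\<dots> = 2 * (1 - 2 * \<epsilon>) * (2 * real n)" unfolding \<epsilon>(2) by simp
          also have "\<dots> \<le> (1 - \<epsilon>) * (q n / real n) * (2 * real n)"
            using elim(2) by (rule mult_right_mono) simp
          also have "\<dots> = (1 - \<epsilon>) * (2 * real n) * (q n / real n)" by (simp only: mult_ac)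
          finally have "a * 4 * p n i / (1 + \<gamma>) * real n \<le> (1 - \<epsilon>) * (2 * real n) * (q n / real n)"
            by (simp only: mult.commute[of a 4])
          then show ?thesis unfolding t_def clock[OF elim(4)] pos_divide_le_eq[OF q_pos'[OF elim(4)]] .
        qed
        have "1 - exp (- (real (card J) * real n powr (- \<beta>) / (4 * C))) - \<delta> / 2 \<le> d n t"
          by (rule elim(3)[rule_format, OF t J_sub in_time])
        moreover have "real n powr \<sigma> - 1 \<le> real (card J)"
        proof -
          have "real n powr \<sigma> \<le> real n powr 1" using \<sigma> elim by (intro powr_mono) auto
          then show ?thesis using card_below_ge[of "real n powr \<sigma>" n] elim by (simp add: J_def)
        qed
        then have "(real n powr \<sigma> - 1) * real n powr (- \<beta>) / (4 * C)
            \<le> real (card J) * real n powr (- \<beta>) / (4 * C)"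
          using C by (intro divide_right_mono mult_right_mono) auto
        then have "exp (- (real (card J) * real n powr (- \<beta>) / (4 * C)))
            \<le> exp (- ((real n powr \<sigma> - 1) * real n powr (- \<beta>) / (4 * C)))" by simp
        ultimately show ?case using elim(1) unfolding t_def by linarith
      qed
    next
      case False
      then have \<gamma>1: "\<gamma> = 1" by (simp add: \<gamma>_def)
      define \<epsilon> where "\<epsilon> = (1 - a) / 2"
      have \<epsilon>: "0 < \<epsilon>" "\<epsilon> < 1" "a = 1 - 2 * \<epsilon>" using a by (auto simp: \<epsilon>_def field_simps)
      note q_ge[OF \<epsilon>(1)] d_lower_fast[OF \<epsilon>(1,2) \<delta>]
      moreover have "eventually (\<lambda>n. 2 \<le> n) sequentially" by (rule eventually_ge_at_top)
      ultimately show ?thesis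
      proof eventually_elim
        case (elim n)
        define t where "t = a * (4 * (real n)\<^sup>2 / (1 + \<gamma>))"
        have t: "0 \<le> t" using a \<gamma> by (simp add: t_def)
        have "p n 1 = 1" using p[of n 1] elim by simp
        then have "a * 4 * p n 1 / (1 + \<gamma>) * real n = 2 * (1 - 2 * \<epsilon>) * real n" by (simp add: \<gamma>1 \<epsilon>(3))
        also have "\<dots> \<le> (1 - \<epsilon>) * (q n / real n) * real n" using elim(1) by (rule mult_right_mono) simp
        also have "\<dots> = (1 - \<epsilon>) * real n * (q n / real n)" by (simp only: mult_ac)
        finally have "clock n t 1 \<le> (1 - \<epsilon>) * real n"
          unfolding t_def clock[OF elim(3)] pos_divide_le_eq[OF q_pos'[OF elim(3)]] .
        then show ?case using elim(2)[rule_format, of t 1] elim(3) t by (simp add: t_def)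
      qed
    qed
  qed (use \<gamma> in auto)
  then show ?thesis by (simp add: \<gamma>_def)
qed

end

section \<open>Mean rates\<close>

text \<open>Mean value theorem; summing it compares \<open>\<Sum> i powr \<alpha>\<close> with the integral of \<open>x powr \<alpha>\<close>.\<close>

lemma powr_increment:
  fixes x \<alpha> :: real
  assumes "0 < x" "0 < \<alpha>"
  shows "(\<alpha> + 1) * x powr \<alpha> \<le> (x + 1) powr (\<alpha> + 1) - x powr (\<alpha> + 1)"
    and "(x + 1) powr (\<alpha> + 1) - x powr (\<alpha> + 1) \<le> (\<alpha> + 1) * (x + 1) powr \<alpha>"
proof -
  have "\<exists>z>x. z < x + 1 \<and> (x + 1) powr (\<alpha> + 1) - x powr (\<alpha> + 1) = (x + 1 - x) * ((\<alpha> + 1) * z powr \<alpha>)"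
  proof (rule MVT2)
    fix z assume "x \<le> z" "z \<le> x + 1"
    then show "((\<lambda>x. x powr (\<alpha> + 1)) has_real_derivative (\<alpha> + 1) * z powr \<alpha>) (at z)"
      using assms has_real_derivative_powr[of z "\<alpha> + 1"] by simp
  qed simp
  then obtain z where "x < z" "z < x + 1"
    and z: "(x + 1) powr (\<alpha> + 1) - x powr (\<alpha> + 1) = (\<alpha> + 1) * z powr \<alpha>" by auto
  then have "x powr \<alpha> \<le> z powr \<alpha>" "z powr \<alpha> \<le> (x + 1) powr \<alpha>"
    using assms by (auto intro!: powr_mono2)
  then show "(\<alpha> + 1) * x powr \<alpha> \<le> (x + 1) powr (\<alpha> + 1) - x powr (\<alpha> + 1)"
    and "(x + 1) powr (\<alpha> + 1) - x powr (\<alpha> + 1) \<le> (\<alpha> + 1) * (x + 1) powr \<alpha>"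
    unfolding z using assms by (auto intro!: mult_left_mono)
qed

lemma sum_powr_bounds:
  fixes \<alpha> :: real
  assumes "0 < \<alpha>"
  shows "(\<alpha> + 1) * (\<Sum>i=1..n. real i powr \<alpha>) \<le> (real n + 1) powr (\<alpha> + 1)"
    and "real n powr (\<alpha> + 1) \<le> (\<alpha> + 1) * (\<Sum>i=1..n. real i powr \<alpha>)"
proof (induction n)
  case 0
  { case 1 show ?case by simp }
  { case 2 show ?case by simp }
next
  case (Suc n)
  { case 1
    show ?case using Suc.IH(1) powr_increment(1)[of "real (Suc n)" \<alpha>] assms
      by (simp add: distrib_left add.commute) }
  { case 2
    show ?case
    proof (cases "n = 0")
      case True
      then show ?thesis using assms by simp
    next
      case False
      then show ?thesis using Suc.IH(2) powr_increment(2)[of "real n" \<alpha>] assms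
        by (simp add: distrib_left add.commute)
    qed }
qed

lemma mean_powr_tendsto:
  fixes \<alpha> :: real
  assumes "0 < \<alpha>"
  shows "(\<lambda>n. (\<Sum>i=1..n. 1 + (real i / real n) powr \<alpha>) / real n) \<longlonglongrightarrow> (\<alpha> + 2) / (\<alpha> + 1)"
proof (rule tendsto_sandwich)
  have eq: "(\<Sum>i=1..n. 1 + (real i / real n) powr \<alpha>) / real n
      = 1 + (\<Sum>i=1..n. real i powr \<alpha>) / real n powr (\<alpha> + 1)" if "0 < n" for n
    using that by (simp add: sum.distrib powr_divide powr_add add_divide_distrib flip: sum_divide_distrib)
  show "eventually (\<lambda>n. 1 + 1 / (\<alpha> + 1) \<le> (\<Sum>i=1..n. 1 + (real i / real n) powr \<alpha>) / real n) sequentially"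
    using eventually_gt_at_top[of 0]
  proof eventually_elim
    case (elim n)
    then show ?case using sum_powr_bounds(2)[OF assms, of n] assms unfolding eq[OF elim]
      by (simp add: field_simps)
  qed
  show "eventually (\<lambda>n. (\<Sum>i=1..n. 1 + (real i / real n) powr \<alpha>) / real n
      \<le> 1 + ((real n + 1) powr (\<alpha> + 1) / real n powr (\<alpha> + 1)) / (\<alpha> + 1)) sequentially"
    using eventually_gt_at_top[of 0]
  proof eventually_elim
    case (elim n)
    have "(\<Sum>i=1..n. real i powr \<alpha>) \<le> (real n + 1) powr (\<alpha> + 1) / (\<alpha> + 1)"
      using sum_powr_bounds(1)[OF assms, of n] assms by (simp add: pos_le_divide_eq mult.commute)
    then have "(\<Sum>i=1..n. real i powr \<alpha>) / real n powr (\<alpha> + 1)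
        \<le> (real n + 1) powr (\<alpha> + 1) / (\<alpha> + 1) / real n powr (\<alpha> + 1)"
      by (rule divide_right_mono) simp
    then show ?case unfolding eq[OF elim] by (simp add: mult.commute)
  qed
  have "1 + 1 / (\<alpha> + 1) = (\<alpha> + 2) / (\<alpha> + 1)" using assms by (simp add: field_simps)
  then show "(\<lambda>n. 1 + 1 / (\<alpha> + 1)) \<longlonglongrightarrow> (\<alpha> + 2) / (\<alpha> + 1)" by simp
  have "(\<lambda>n. (real n + 1) powr (\<alpha> + 1) / real n powr (\<alpha> + 1)) \<longlonglongrightarrow> 1"
    using assms by real_asymp
  then have "(\<lambda>n. 1 + ((real n + 1) powr (\<alpha> + 1) / real n powr (\<alpha> + 1)) / (\<alpha> + 1)) \<longlonglongrightarrow> 1 + 1 / (\<alpha> + 1)"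
    using assms by (intro tendsto_intros) auto
  then show "(\<lambda>n. 1 + ((real n + 1) powr (\<alpha> + 1) / real n powr (\<alpha> + 1)) / (\<alpha> + 1)) \<longlonglongrightarrow> (\<alpha> + 2) / (\<alpha> + 1)"
    by (simp only: \<open>1 + 1 / (\<alpha> + 1) = (\<alpha> + 2) / (\<alpha> + 1)\<close>)
qed

lemma sum_two_powr_le: "(\<Sum>i=1..n. 2 powr (real i - real n)) \<le> 2"
proof (induction n)
  case (Suc n)
  have "(\<Sum>i=1..n. 2 powr (real i - real (Suc n))) = (\<Sum>i=1..n. 2 powr (real i - real n)) / 2"
    unfolding sum_divide_distrib by (intro sum.cong) (auto simp: powr_diff powr_add)
  then show ?case using Suc by simp
qed simp

lemma mean_two_powr_tendsto:
  "(\<lambda>n. (\<Sum>i=1..n. 1 + 2 powr (real i - real n)) / real n) \<longlonglongrightarrow> 1"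
proof (rule tendsto_sandwich[of "\<lambda>_. 1" _ _ "\<lambda>n. 1 + 2 / real n"])
  show "eventually (\<lambda>n. 1 \<le> (\<Sum>i=1..n. 1 + 2 powr (real i - real n)) / real n) sequentially"
    using eventually_gt_at_top[of 0]
  proof eventually_elim
    case (elim n)
    have "0 \<le> (\<Sum>i=1..n. 2 powr (real i - real n))" by (intro sum_nonneg) simp
    then show ?case using elim by (simp add: sum.distrib pos_le_divide_eq)
  qed
  show "eventually (\<lambda>n. (\<Sum>i=1..n. 1 + 2 powr (real i - real n)) / real n \<le> 1 + 2 / real n) sequentially"
    using eventually_gt_at_top[of 0]
  proof eventually_elim
    case (elim n)
    then show ?case using sum_two_powr_le[of n] by (simp add: sum.distrib add_divide_distrib divide_right_mono)
  qed
  show "(\<lambda>n. 1 + 2 / real n) \<longlonglongrightarrow> 1" by real_asymp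
qed auto

lemma sum_ln_ge: "real n * ln (real n) - real n \<le> (\<Sum>i=1..n. ln (real i))"
proof (induction n)
  case (Suc n)
  have "real n * ln (real (Suc n)) - real n * ln (real n) \<le> 1"
  proof (cases "n = 0")
    case False
    then have "1 + 1 / real n = real (Suc n) / real n" by (simp add: field_simps)
    then have "ln (real (Suc n)) - ln (real n) = ln (1 + 1 / real n)"
      using False by (simp add: ln_div del: of_nat_Suc)
    also have "\<dots> \<le> 1 / real n" using False by (intro ln_add_one_self_le_self) auto
    finally have "real n * (ln (real (Suc n)) - ln (real n)) \<le> real n * (1 / real n)"
      by (intro mult_left_mono) auto
    then show ?thesis using False by (simp add: algebra_simps)
  qed simp
  then show ?case using Suc by (simp add: algebra_simps)
qed simp

lemma mean_ln_tendsto: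
  "(\<lambda>n. (\<Sum>i=1..n. 1 + ln (real i) / ln (real n)) / real n) \<longlonglongrightarrow> 2"
proof (rule tendsto_sandwich[of "\<lambda>n. 2 - 1 / ln (real n)" _ _ "\<lambda>_. 2"])
  have eq: "(\<Sum>i=1..n. 1 + ln (real i) / ln (real n)) = real n + (\<Sum>i=1..n. ln (real i)) / ln (real n)" for n
    by (simp add: sum.distrib sum_divide_distrib)
  show "eventually (\<lambda>n. 2 - 1 / ln (real n) \<le> (\<Sum>i=1..n. 1 + ln (real i) / ln (real n)) / real n) sequentially"
    using eventually_ge_at_top[of 2]
  proof eventually_elim
    case (elim n)
    have "(real n * ln (real n) - real n) / ln (real n) \<le> (\<Sum>i=1..n. ln (real i)) / ln (real n)"
      using sum_ln_ge[of n] elim by (intro divide_right_mono) auto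
    then have "real n * (2 - 1 / ln (real n)) \<le> real n + (\<Sum>i=1..n. ln (real i)) / ln (real n)"
      using elim by (simp add: diff_divide_distrib right_diff_distrib)
    then show ?case unfolding eq using elim by (simp add: pos_le_divide_eq mult.commute)
  qed
  show "eventually (\<lambda>n. (\<Sum>i=1..n. 1 + ln (real i) / ln (real n)) / real n \<le> 2) sequentially"
    using eventually_ge_at_top[of 2]
  proof eventually_elim
    case (elim n)
    have "(\<Sum>i=1..n. 1 + ln (real i) / ln (real n)) \<le> (\<Sum>i=1..n. 2)"
      using elim by (intro sum_mono) (auto simp: pos_divide_le_eq)
    then show ?case using elim by (simp add: pos_divide_le_eq)
  qed
  show "(\<lambda>n. 2 - 1 / ln (real n)) \<longlonglongrightarrow> 2" by real_asymp
qed auto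

section \<open>The three families of rates\<close>

theorem proposition1p2:
  fixes \<beta> :: real
    and p a b c :: "nat \<Rightarrow> nat \<Rightarrow> real"
    and \<pi> :: "nat \<Rightarrow> nat \<Rightarrow> nat \<Rightarrow> real"
    and q :: "nat \<Rightarrow> real"
    and X :: "nat \<Rightarrow> (nat \<Rightarrow> nat) set"
    and K :: "nat \<Rightarrow> (nat \<Rightarrow> nat) kernel"
    and \<mu> :: "nat \<Rightarrow> (nat \<Rightarrow> nat) \<Rightarrow> real"
  assumes \<beta>: "\<beta> > 0"
    and p_pos: "\<forall>n\<ge>2. \<forall>i\<in>{1..n}. p n i > 0"
    and chain: "\<forall>n\<ge>2. \<forall>i\<in>{1..n}.
          irreducible_markov_chain {0..2 * n}
            (shortcut_kernel \<beta> n (a n i) (b n i) (c n i)) (\<pi> n i)"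
    and reversible: "\<forall>n\<ge>2. \<forall>i\<in>{1..n}.
          b n i * c n i * (1 - a n i) ^ (n - 1) * real n powr (- \<beta>)
            = (1 - a n i - b n i * real n powr (- \<beta>)) * a n i ^ n"
    and bounds: "\<exists>C>1. \<forall>n\<ge>2.
          (\<Sum>i=1..n. a n i) \<le> C * real n powr (- \<beta> - 1) \<and>
          (\<forall>i\<in>{1..n}. inverse C \<le> b n i \<and> b n i \<le> C)"
  defines "q \<equiv> \<lambda>n. \<Sum>i=1..n. p n i"
    and "X \<equiv> \<lambda>n. product_space {1..n} (\<lambda>i. {0..2 * n})"
    and "K \<equiv> \<lambda>n. product_kernel {1..n} (\<lambda>i. p n i / q n)
                 (\<lambda>i. shortcut_kernel \<beta> n (a n i) (b n i) (c n i))"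
    and "\<mu> \<equiv> \<lambda>n. product_distribution {1..n} (\<pi> n)"
  shows
    "((\<forall>n\<ge>2. \<forall>i\<in>{1..n}. p n i = 1 + 2 powr (real i - real n)) \<longrightarrow>
        (tv_cutoff_c 2 X K \<mu> \<longleftrightarrow> \<beta> \<noteq> 1) \<and>
        (\<beta> < 1 \<longrightarrow> tv_cutoff_c_at 2 X K \<mu> (\<lambda>n. 2 * (real n)\<^sup>2)) \<and>
        (\<beta> > 1 \<longrightarrow> tv_cutoff_c_at 2 X K \<mu> (\<lambda>n. (real n)\<^sup>2)))
     \<and> (\<forall>\<alpha>>0. (\<forall>n\<ge>2. \<forall>i\<in>{1..n}. p n i = 1 + (real i / real n) powr \<alpha>) \<longrightarrow>
        (tv_cutoff_c 2 X K \<mu> \<longleftrightarrow> \<beta> \<noteq> 1) \<and>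
        (\<beta> < 1 \<longrightarrow> tv_cutoff_c_at 2 X K \<mu> (\<lambda>n. 2 * ((\<alpha> + 2) / (\<alpha> + 1)) * (real n)\<^sup>2)) \<and>
        (\<beta> > 1 \<longrightarrow> tv_cutoff_c_at 2 X K \<mu> (\<lambda>n. (\<alpha> + 2) / (\<alpha> + 1) * (real n)\<^sup>2)))
     \<and> ((\<forall>n\<ge>2. \<forall>i\<in>{1..n}. p n i = 1 + ln (real i) / ln (real n)) \<longrightarrow>
        tv_cutoff_c_at 2 X K \<mu> (\<lambda>n. 4 * (real n)\<^sup>2 / (1 + min \<beta> 1)))"
proof -
  obtain C where C: "1 < C" "\<forall>n\<ge>2. (\<Sum>i=1..n. a n i) \<le> C * real n powr (- \<beta> - 1) \<and>
          (\<forall>i\<in>{1..n}. inverse C \<le> b n i \<and> b n i \<le> C)"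
    using bounds by blast
  interpret shortcut_family \<beta> C p a b c \<pi> q X K \<mu>
    unfolding shortcut_family_def q_def X_def K_def \<mu>_def
    using \<beta> p_pos chain reversible C by simp
  have q_lim: "(\<lambda>n. q n / real n) \<longlonglongrightarrow> l"
    if p: "\<forall>n\<ge>2. \<forall>i\<in>{1..n}. p n i = r n i"
      and r: "(\<lambda>n. (\<Sum>i=1..n. r n i) / real n) \<longlonglongrightarrow> l" for r l
  proof (rule Lim_transform_eventually[OF r])
    show "eventually (\<lambda>n. (\<Sum>i=1..n. r n i) / real n = q n / real n) sequentially"
      using eventually_ge_at_top[of "2 :: nat"] by (rule eventually_mono) (simp add: q_def p)
  qed
  show ?thesis
  proof (intro conjI allI impI)
    assume p: "\<forall>n\<ge>2. \<forall>i\<in>{1..n}. p n i = 1 + 2 powr (real i - real n)"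
    interpret regular_rates \<beta> C p a b c \<pi> q X K \<mu> 1
    proof unfold_locales
      show "(\<lambda>n. (\<Sum>i=1..n. p n i) / real n) \<longlonglongrightarrow> 1"
        by (rule q_lim[OF p mean_two_powr_tendsto, unfolded q_def])
      show "1 \<le> p n i" if "2 \<le> n" "i \<in> {1..n}" for n i using p that by simp
      fix \<epsilon> :: real assume \<epsilon>: "0 < \<epsilon>"
      \<comment> \<open>Up to index \<open>n / 2\<close> the rates exceed \<open>1\<close> by at most \<open>2 powr (- n / 2)\<close>.\<close>
      have "(\<lambda>n. 2 powr (1 / 2 * real n - real n)) \<longlonglongrightarrow> 0" by real_asymp
      then have "eventually (\<lambda>n. 2 powr (1 / 2 * real n - real n) < \<epsilon>) sequentially"
        by (rule order_tendstoD) (rule \<epsilon>)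
      then have "eventually (\<lambda>n. \<forall>i\<in>{1..n}. real i \<le> 1 / 2 * real n \<longrightarrow> p n i \<le> 1 + \<epsilon>) sequentially"
        using eventually_ge_at_top[of 2]
      proof eventually_elim
        case (elim n)
        show ?case
        proof (intro ballI impI)
          fix i assume i: "i \<in> {1..n}" "real i \<le> 1 / 2 * real n"
          then have "2 powr (real i - real n) \<le> 2 powr (1 / 2 * real n - real n)" by (intro powr_mono) auto
          also have "\<dots> < \<epsilon>" by (rule elim)
          finally have "2 powr (real i - real n) < \<epsilon>" .
          then show "p n i \<le> 1 + \<epsilon>" using p i elim by simp
        qed
      qed
      then show "\<exists>\<delta>>0. eventually (\<lambda>n. \<forall>i\<in>{1..n}. real i \<le> \<delta> * real n \<longrightarrow> p n i \<le> 1 + \<epsilon>) sequentially"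
        by (intro exI[of _ "1 / 2"]) auto
    qed simp
    note * = cutoff_regular_rates[unfolded mult_1_right mult_1_left]
    show "tv_cutoff_c 2 X K \<mu> \<longleftrightarrow> \<beta> \<noteq> 1" using * by blast
    show "tv_cutoff_c_at 2 X K \<mu> (\<lambda>n. 2 * (real n)\<^sup>2)" if "\<beta> < 1" using * that by blast
    show "tv_cutoff_c_at 2 X K \<mu> (\<lambda>n. (real n)\<^sup>2)" if "\<beta> > 1" using * that by blast
  next
    fix \<alpha> :: real
    assume \<alpha>: "0 < \<alpha>" and p: "\<forall>n\<ge>2. \<forall>i\<in>{1..n}. p n i = 1 + (real i / real n) powr \<alpha>"
    interpret regular_rates \<beta> C p a b c \<pi> q X K \<mu> "(\<alpha> + 2) / (\<alpha> + 1)"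
    proof unfold_locales
      show "0 < (\<alpha> + 2) / (\<alpha> + 1)" using \<alpha> by simp
      show "(\<lambda>n. (\<Sum>i=1..n. p n i) / real n) \<longlonglongrightarrow> (\<alpha> + 2) / (\<alpha> + 1)"
        by (rule q_lim[OF p mean_powr_tendsto[OF \<alpha>], unfolded q_def])
      show "1 \<le> p n i" if "2 \<le> n" "i \<in> {1..n}" for n i using p that by simp
      fix \<epsilon> :: real assume \<epsilon>: "0 < \<epsilon>"
      have "eventually (\<lambda>n. \<forall>i\<in>{1..n}. real i \<le> \<epsilon> powr (1 / \<alpha>) * real n \<longrightarrow> p n i \<le> 1 + \<epsilon>) sequentially"
        using eventually_ge_at_top[of 2]
      proof eventually_elim
        case (elim n)
        show ?case
        proof (intro ballI impI)
          fix i assume i: "i \<in> {1..n}" "real i \<le> \<epsilon> powr (1 / \<alpha>) * real n"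
          then have "(real i / real n) powr \<alpha> \<le> (\<epsilon> powr (1 / \<alpha>)) powr \<alpha>"
            using elim \<alpha> by (intro powr_mono2) (auto simp: pos_divide_le_eq)
          also have "\<dots> = \<epsilon>" using \<alpha> \<epsilon> by (simp add: powr_powr)
          finally show "p n i \<le> 1 + \<epsilon>" using p i elim by simp
        qed
      qed
      then show "\<exists>\<delta>>0. eventually (\<lambda>n. \<forall>i\<in>{1..n}. real i \<le> \<delta> * real n \<longrightarrow> p n i \<le> 1 + \<epsilon>) sequentially"
        using \<epsilon> by (intro exI[of _ "\<epsilon> powr (1 / \<alpha>)"]) auto
    qed
    note * = cutoff_regular_rates
    show "tv_cutoff_c 2 X K \<mu> \<longleftrightarrow> \<beta> \<noteq> 1" using * by blast
    show "tv_cutoff_c_at 2 X K \<mu> (\<lambda>n. 2 * ((\<alpha> + 2) / (\<alpha> + 1)) * (real n)\<^sup>2)" if "\<beta> < 1" using * that by blast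
    show "tv_cutoff_c_at 2 X K \<mu> (\<lambda>n. (\<alpha> + 2) / (\<alpha> + 1) * (real n)\<^sup>2)" if "\<beta> > 1" using * that by blast
  next
    assume p: "\<forall>n\<ge>2. \<forall>i\<in>{1..n}. p n i = 1 + ln (real i) / ln (real n)"
    show "tv_cutoff_c_at 2 X K \<mu> (\<lambda>n. 4 * (real n)\<^sup>2 / (1 + min \<beta> 1))"
      by (rule cutoff_logarithmic_rates[OF _ q_lim[OF p mean_ln_tendsto]]) (use p in blast)
  qed
qed

end
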